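(* Let $3 \leq n_1 < n_2 < \ldots$ be any eventually periodic (infinite) sequence of integers, meaning that for some $p \geq 1$ we have $$\exists n_0:\ \forall n \geq n_0:\ \big( n \in \{n_i \mid i \in \mathbb{Z}_+\} \iff n+p \in \{n_i \mid i \in \mathbb{Z}_+\}\big).$$ Then the generalized Neumann group corresponding to the sequence $(n_i)_i$ belongs to $\mathcal{G}$.
   Context: $\mathbb{Z}_+=\{1,2,\ldots\}$. For a finite set (alphabet) $\Sigma$, the full shift $\Sigma^{\mathbb{Z}}$ carries the product topology and the shift homeomorphism $\sigma(x)_i = x_{i+1}$. $\mathrm{Aut}(\Sigma^{\mathbb{Z}})$ is the group of homeomorphisms of $\Sigma^{\mathbb{Z}}$ commuting with $\sigma$. $\mathcal{G}$ is the class of groups that embed (as abstract groups) in $\mathrm{Aut}(\Sigma^{\mathbb{Z}})$, where $\Sigma$ is a finite alphabet with at least two elements; it is known that this class does not depend on the choice of such $\Sigma$. For integers $3\le n_1<n_2<\ldots$ and distinct elements $u_{i,j}$ ($i\in\mathbb{Z}_+$, $1\le j\le n_i$), the generalized Neumann group corresponding to $(n_i)_i$ is the subgroup of the (unrestricted) direct product of symmetric groups $\prod_i \mathrm{Sym}(\{u_{i,j} \mid 1\le j\le n_i\})$ generated by the two elements $a=\prod_i (u_{i,1}\; u_{i,2}\; u_{i,3})$ (a $3$-cycle in each factor) and $b=\prod_i(u_{i,1}\; u_{i,2}\;\ldots\; u_{i,n_i})$ (the full cycle in each factor). *)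

theory Defs
  imports "HOL-Analysis.Abstract_Topology" "HOL-Analysis.Product_Topology"
    "HOL-Analysis.Function_Topology" "HOL-Algebra.Algebra" "HOL-Combinatorics.Cycles"
begin

section \<open>Automorphism groups of full shifts\<close>

definition full_shift :: "'a set \<Rightarrow> (int \<Rightarrow> 'a) topology" where
  "full_shift \<Sigma> = product_topology (\<lambda>_. discrete_topology \<Sigma>) UNIV"

definition shift :: "(int \<Rightarrow> 'a) \<Rightarrow> (int \<Rightarrow> 'a)" where
  "shift x = (\<lambda>i. x (i + 1))"

text \<open>Self-maps of the full shift are taken to be extensional, as in \<^const>\<open>BijGroup\<close>, so that
  they are determined by their values on configurations over \<open>\<Sigma>\<close>.\<close>

definition Aut_full_shift :: "'a set \<Rightarrow> ((int \<Rightarrow> 'a) \<Rightarrow> (int \<Rightarrow> 'a)) monoid" where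
  "Aut_full_shift \<Sigma> = (BijGroup (topspace (full_shift \<Sigma>)))
     \<lparr>carrier := {f \<in> extensional (topspace (full_shift \<Sigma>)).
        homeomorphic_map (full_shift \<Sigma>) (full_shift \<Sigma>) f \<and>
        (\<forall>x \<in> topspace (full_shift \<Sigma>). f (shift x) = shift (f x))}\<rparr>"

lemma topspace_full_shift: "topspace (full_shift \<Sigma>) = {x. \<forall>i. x i \<in> \<Sigma>}"
  by (auto simp: full_shift_def)

lemma shift_in_full_shift: "x \<in> topspace (full_shift \<Sigma>) \<Longrightarrow> shift x \<in> topspace (full_shift \<Sigma>)"
  by (simp add: topspace_full_shift shift_def)

lemma subgroup_Aut_full_shift:
  "subgroup (carrier (Aut_full_shift \<Sigma>)) (BijGroup (topspace (full_shift \<Sigma>)))"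
proof -
  let ?X = "full_shift \<Sigma>"
  let ?T = "topspace ?X"
  let ?B = "BijGroup ?T"
  interpret B: group ?B by (rule group_BijGroup)
  have car: "f \<in> carrier (Aut_full_shift \<Sigma>) \<longleftrightarrow> f \<in> extensional ?T \<and> homeomorphic_map ?X ?X f \<and>
      (\<forall>x \<in> ?T. f (shift x) = shift (f x))" for f
    by (simp add: Aut_full_shift_def)
  have Bij: "f \<in> Bij ?T" if "f \<in> carrier (Aut_full_shift \<Sigma>)" for f
    using that
    by (simp add: car Bij_def bij_betw_def)
      (metis homeomorphic_imp_injective_map homeomorphic_imp_surjective_map)
  show ?thesis
  proof (rule B.subgroupI)
    show "carrier (Aut_full_shift \<Sigma>) \<subseteq> carrier ?B"
      using Bij by (auto simp: BijGroup_def)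
    have "(\<lambda>x\<in>?T. x) \<in> carrier (Aut_full_shift \<Sigma>)"
      by (auto simp: car shift_in_full_shift intro: homeomorphic_map_eq[OF homeomorphic_map_id[THEN iffD2]])
    then show "carrier (Aut_full_shift \<Sigma>) \<noteq> {}" by blast
  next
    fix f g assume f: "f \<in> carrier (Aut_full_shift \<Sigma>)" and g: "g \<in> carrier (Aut_full_shift \<Sigma>)"
    have gT: "g x \<in> ?T" if "x \<in> ?T" for x
      using Bij[OF g] that by (auto simp: Bij_def bij_betw_def)
    have "homeomorphic_map ?X ?X (compose ?T f g)"
      by (rule homeomorphic_map_eq[of _ _ "f \<circ> g"])
         (use f g in \<open>auto simp: car compose_eq intro: homeomorphic_map_compose\<close>)
    then have "compose ?T f g \<in> carrier (Aut_full_shift \<Sigma>)"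
      using f g gT by (simp add: car compose_eq shift_in_full_shift)
    then show "f \<otimes>\<^bsub>?B\<^esub> g \<in> carrier (Aut_full_shift \<Sigma>)"
      using Bij[OF f] Bij[OF g] by (simp add: BijGroup_def)
  next
    fix f assume f: "f \<in> carrier (Aut_full_shift \<Sigma>)"
    let ?g = "\<lambda>x\<in>?T. inv_into ?T f x"
    have bij: "bij_betw f ?T ?T" using Bij[OF f] by (simp add: Bij_def)
    obtain g where g: "homeomorphic_maps ?X ?X f g"
      using f unfolding car homeomorphic_map_maps by blast
    have eq: "inv_into ?T f x = g x" if "x \<in> ?T" for x
    proof (rule inv_into_f_eq)
      show "inj_on f ?T" using bij by (simp add: bij_betw_def)
      show "g x \<in> ?T" "f (g x) = x"
        using g that by (auto simp: homeomorphic_maps_def continuous_map_def)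
    qed
    have "homeomorphic_map ?X ?X g" using g homeomorphic_maps_map by blast
    then have hom: "homeomorphic_map ?X ?X ?g"
      by (rule homeomorphic_map_eq) (simp add: eq)
    have "?g (shift x) = shift (?g x)" if x: "x \<in> ?T" for x
    proof -
      have gx: "g x \<in> ?T" "f (g x) = x"
        using g x by (auto simp: homeomorphic_maps_def continuous_map_def)
      have "f (shift (g x)) = shift x" using f gx by (simp add: car)
      then have "g (shift x) = shift (g x)"
        using g shift_in_full_shift[OF gx(1)] by (metis homeomorphic_maps_def)
      then show ?thesis using x shift_in_full_shift[OF x] by (simp add: eq)
    qed
    then have "?g \<in> carrier (Aut_full_shift \<Sigma>)" using hom by (simp add: car)
    then show "inv\<^bsub>?B\<^esub> f \<in> carrier (Aut_full_shift \<Sigma>)"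
      using inv_BijGroup[OF Bij[OF f]] by simp
  qed
qed

lemma group_Aut_full_shift: "group (Aut_full_shift \<Sigma>)"
  using group.subgroup_imp_group[OF group_BijGroup subgroup_Aut_full_shift]
  by (simp add: Aut_full_shift_def)

text \<open>The class of groups embedding in the automorphism group of a full shift is independent of
  the finite alphabet \<open>\<Sigma>\<close> with at least two elements. The alphabet is kept as a
  parameter, so that a membership statement can be made for every such \<open>\<Sigma>\<close>.\<close>

definition in_class_G :: "'a set \<Rightarrow> 'g monoid \<Rightarrow> bool" where
  "in_class_G \<Sigma> G \<longleftrightarrow> group G \<and> mon G (Aut_full_shift \<Sigma>) \<noteq> {}"

section \<open>Generalized Neumann groups\<close>

text \<open>The factors are indexed by the positive integers; \<open>u i j\<close> is only meaningful for
  \<open>1 \<le> i\<close> and \<open>1 \<le> j \<le> n i\<close>.\<close>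

definition neumann_points :: "(nat \<Rightarrow> nat) \<Rightarrow> (nat \<Rightarrow> nat \<Rightarrow> 'u) \<Rightarrow> nat \<Rightarrow> 'u set" where
  "neumann_points n u i = u i ` {1..n i}"

definition neumann_product :: "(nat \<Rightarrow> nat) \<Rightarrow> (nat \<Rightarrow> nat \<Rightarrow> 'u) \<Rightarrow> (nat \<Rightarrow> 'u \<Rightarrow> 'u) monoid" where
  "neumann_product n u = product_group {1..} (\<lambda>i. BijGroup (neumann_points n u i))"

definition neumann_a :: "(nat \<Rightarrow> nat) \<Rightarrow> (nat \<Rightarrow> nat \<Rightarrow> 'u) \<Rightarrow> nat \<Rightarrow> 'u \<Rightarrow> 'u" where
  "neumann_a n u = (\<lambda>i\<in>{1..}. restrict (cycle_of_list [u i 1, u i 2, u i 3]) (neumann_points n u i))"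

definition neumann_b :: "(nat \<Rightarrow> nat) \<Rightarrow> (nat \<Rightarrow> nat \<Rightarrow> 'u) \<Rightarrow> nat \<Rightarrow> 'u \<Rightarrow> 'u" where
  "neumann_b n u =
     (\<lambda>i\<in>{1..}. restrict (cycle_of_list (map (u i) [1..<Suc (n i)])) (neumann_points n u i))"

definition generalized_neumann_group ::
    "(nat \<Rightarrow> nat) \<Rightarrow> (nat \<Rightarrow> nat \<Rightarrow> 'u) \<Rightarrow> (nat \<Rightarrow> 'u \<Rightarrow> 'u) monoid" where
  "generalized_neumann_group n u =
     subgroup_generated (neumann_product n u) {neumann_a n u, neumann_b n u}"

lemma restrict_permutes_Bij: "p permutes S \<Longrightarrow> restrict p S \<in> Bij S"
  by (simp add: Bij_def permutes_imp_bij bij_betw_restrict_eq)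

text \<open>\<^const>\<open>subgroup_generated\<close> discards generators outside the carrier;
  here both generators lie in it.\<close>

lemma neumann_generators_in_carrier:
  assumes "\<And>i. i \<ge> 1 \<Longrightarrow> n i \<ge> 3"
  shows "{neumann_a n u, neumann_b n u} \<subseteq> carrier (neumann_product n u)"
proof -
  have "cycle_of_list [u i 1, u i 2, u i 3] permutes neumann_points n u i" if "i \<ge> 1" for i
    by (rule permutes_subset[OF cycle_permutes])
       (use assms[OF that] in \<open>auto simp: neumann_points_def\<close>)
  moreover have "cycle_of_list (map (u i) [1..<Suc (n i)]) permutes neumann_points n u i" for i
    by (rule permutes_subset[OF cycle_permutes]) (auto simp: neumann_points_def)
  ultimately show ?thesis
    by (auto simp: neumann_a_def neumann_b_def neumann_product_def BijGroup_def
        simp del: upt_Suc intro!: restrict_permutes_Bij)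
qed

definition eventually_periodic_seq :: "(nat \<Rightarrow> nat) \<Rightarrow> bool" where
  "eventually_periodic_seq n \<longleftrightarrow>
     (\<exists>p\<ge>1. \<exists>n0. \<forall>m\<ge>n0. m \<in> n ` {1..} \<longleftrightarrow> m + p \<in> n ` {1..})"

end

theory Submission
  imports Defs
begin

text \<open>Write \<open>N\<close> for the set of the \<open>n i\<close>. The idea is to let configurations contain finite chains
  of data cells, called belts, such that the number of cells on a belt always lies in \<open>N\<close> and
  every element of \<open>N\<close> is the length of some belt. A permutation of \<open>{..<v}\<close> for each
  \<open>v \<in> N\<close> then permutes the contents of the cells on all belts of length \<open>v\<close> at once, and
  the generators \<open>a\<close> and \<open>b\<close> have to be realised in this way by local rules.

  Two things must be arranged. Belt lengths have to be controlled locally, and this is where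
  eventual periodicity enters. Choose an even period \<open>p \<ge> 4\<close> that is large enough for
  \<open>v \<in> N\<close> and \<open>v + p \<in> N\<close> to be equivalent for all \<open>v \<ge> p\<close>. A belt is built
  from tiles, which are words of a fixed shape that cannot overlap. Each tile carries a type
  \<open>t \<in> N\<close> with \<open>t < 2 * p\<close>. A tile of type below \<open>p\<close> is a belt of \<open>t\<close> cells
  on its own. A tile of type at least \<open>p\<close> contributes \<open>p\<close> cells and continues into the next
  tile if there is one of this kind directly after it; otherwise it contributes \<open>t\<close> cells and
  the belt ends. No arrangement of tiles is faulty, and all lengths of finite belts lie in \<open>N\<close>
  (\<open>belt_length_in_N\<close>).

  Secondly, a full cycle of a long belt must move no cell far. Number the cells of a belt from
  \<open>0\<close> and let the cycle run up through the even numbers and back through the odd ones. It is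
  the product of two involutions, one swapping the cells \<open>2 * k\<close> and \<open>2 * k + 1\<close>, the other
  the cells \<open>2 * k + 1\<close> and \<open>2 * k + 2\<close>. The 3-cycle on three consecutive points of this cycle
  is the product of the swaps of the cells \<open>0, 1\<close> and \<open>1, 2\<close> at the beginning of the belt. All
  four involutions are given by local rules. Since they change neither the tiles nor the belts,
  they are involutive automorphisms of the full shift (\<open>marked_swap_in_Aut\<close>). In this way a
  separate construction of inverse automorphisms is avoided.

  Configurations with finite support have only finite belts and are dense. Hence an
  automorphism that permutes the cells of finite belts is determined by the permutations, and
  it determines them because every length in \<open>N\<close> occurs and the contents of the cells are
  arbitrary (\<open>Aut_eq_one_if_acts_trivially\<close>, \<open>trivial_if_acts_by_identity\<close>). The pairs of a
  family of permutations and an automorphism acting by it thus form a correspondence that is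
  injective in both directions. It contains pairs for \<open>a\<close> and for \<open>b\<close>, and so yields the
  embedding (\<open>mon_from_correspondence\<close>).\<close>

section \<open>Tiles, belts and their lengths\<close>

locale belt_coding =
  fixes p :: nat and N :: "nat set" and hi lo :: 'a
  assumes even_p: "even p" and p_ge: "p \<ge> 4"
    and N_ge: "\<And>v. v \<in> N \<Longrightarrow> v \<ge> 3"
    and N_period: "\<And>v. v \<ge> p \<Longrightarrow> v + p \<in> N \<longleftrightarrow> v \<in> N"
    and hi_neq_lo: "hi \<noteq> lo"
begin

text \<open>A tile of type \<open>t\<close> has the form \<open>hi hi lo w lo (d lo)\<^sup>k\<close> with \<open>k = 2 * p\<close>, where \<open>w\<close> is a word of
  length \<open>2 * p\<close> with a single \<open>hi\<close> at place \<open>t\<close>, and each \<open>d\<close> is a free data symbol in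
  \<open>{hi, lo}\<close>. The data begin at offset \<open>D\<close>, and \<open>L\<close> is the length of a tile.\<close>

definition D :: int where "D = 4 + 2 * int p"

definition L :: int where "L = 4 + 6 * int p"

definition pos :: "int \<Rightarrow> nat \<Rightarrow> int" where
  "pos i j = i + D + 2 * int j"

definition tile :: "(int \<Rightarrow> 'a) \<Rightarrow> int \<Rightarrow> nat \<Rightarrow> bool" where
  "tile x i t \<longleftrightarrow> t \<in> N \<and> t < 2 * p \<and>
     (\<forall>r. 0 \<le> r \<longrightarrow> r < L \<longrightarrow>
        (if D \<le> r \<and> even r then x (i + r) \<in> {hi, lo}
         else x (i + r) = (if r < 2 \<or> r = 3 + int t then hi else lo)))"

text \<open>All further notions depend on a configuration only through its relation \<open>T i t\<close>, ``a tile of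
  type \<open>t\<close> starts at \<open>i\<close>''. Treating \<open>T\<close> as a parameter makes it evident that they are
  unaffected by changes of the data.\<close>

definition skeleton :: "(int \<Rightarrow> nat \<Rightarrow> bool) \<Rightarrow> bool" where
  "skeleton T \<longleftrightarrow> (\<forall>i t. T i t \<longrightarrow> t \<in> N \<and> t < 2 * p) \<and>
     (\<forall>i t i' t'. T i t \<longrightarrow> T i' t' \<longrightarrow> \<bar>i - i'\<bar> < L \<longrightarrow> i = i' \<and> t = t')"

text \<open>Tiles do not overlap because the word \<open>hi hi\<close> occurs in a tile only at its beginning: the
  type is marked by a single \<open>hi\<close> between two \<open>lo\<close>, and data symbols are separated by \<open>lo\<close>.\<close>

lemma skeleton_tile: "skeleton (tile x)"
proof -
  have at: "x (i + r) = (if r < 2 \<or> r = 3 + int t then hi else lo)"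
    if "tile x i t" "0 \<le> r" "r < L" "\<not> (D \<le> r \<and> even r)" for i t r
  proof -
    have "if D \<le> r \<and> even r then x (i + r) \<in> {hi, lo}
      else x (i + r) = (if r < 2 \<or> r = 3 + int t then hi else lo)"
      using that(1-3) unfolding tile_def by blast
    then show ?thesis unfolding if_not_P[OF that(4)] .
  qed
  have hi_at: "r < 2 \<or> r = 3 + int t \<or> (D \<le> r \<and> even r)"
    if "tile x i t" "0 \<le> r" "r < L" "x (i + r) = hi" for i t r
  proof (rule ccontr)
    assume *: "\<not> ?thesis"
    then have "x (i + r) = (if r < 2 \<or> r = 3 + int t then hi else lo)"
      by (intro at[OF that(1-3)]) blast
    also have "\<dots> = lo" using * by (simp only: if_not_P de_Morgan_disj if_False simp_thms)
    finally show False using that(4) hi_neq_lo by simp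
  qed
  have ty: "int t < 2 * int p" if "tile x i t" for i t
  proof -
    have "t < 2 * p" using that unfolding tile_def by blast
    then show ?thesis by linarith
  qed
  have p4: "int p \<ge> 4" using p_ge by linarith
  have L_pos: "L > 2" and D_pos: "D > 2" and D_less: "D < L"
    using p4 unfolding L_def D_def by linarith+
  have no_overlap: False if "tile x i t" "tile x (i + r) t'" "0 < r" "r < L" for i r t t'
  proof -
    \<comment> \<open>A tile starting at offset \<open>r\<close> of another tile would produce the word \<open>hi hi\<close> there.\<close>
    have "x (i + r + 0) = hi" using at[OF that(2), of 0] L_pos D_pos by simp
    moreover have "x (i + r + 1) = hi" using at[OF that(2), of 1] L_pos by simp
    ultimately have h: "x (i + r) = hi" "x (i + (r + 1)) = hi"
      by (simp_all add: add.assoc)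
    have "r < 2 \<or> r = 3 + int t \<or> (D \<le> r \<and> even r)"
      using hi_at[OF that(1) _ that(4) h(1)] that(3) by simp
    moreover have "r + 1 = L \<or> r + 1 < 2 \<or> r + 1 = 3 + int t \<or> (D \<le> r + 1 \<and> odd r)"
    proof (cases "r + 1 = L")
      case False
      then show ?thesis using hi_at[OF that(1) _ _ h(2)] that(3,4) by simp
    qed simp
    moreover have "odd r" if "r + 1 = L"
    proof -
      have "even (r + 1)" unfolding that L_def by simp
      then show ?thesis by simp
    qed
    moreover note ty[OF that(1)] that(3,4) D_def L_def
    ultimately show False by (elim disjE conjE; simp)
  qed
  have same: "i = i' \<and> t = t'" if "tile x i t" "tile x i' t'" "\<bar>i - i'\<bar> < L" for i i' t t'
  proof -
    have "\<not> i < i'" using no_overlap[of i t "i' - i" t'] that by auto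
    moreover have "\<not> i' < i" using no_overlap[of i' t' "i - i'" t] that by auto
    ultimately have i: "i = i'" by simp
    have r: "3 + int t < D" using ty[OF that(1)] unfolding D_def by linarith
    have "x (i + (3 + int t)) = hi"
      using at[OF that(1), of "3 + int t"] r D_less by simp
    then have "3 + int t < 2 \<or> 3 + int t = 3 + int t' \<or> (D \<le> 3 + int t \<and> even (3 + int t))"
      unfolding i by (rule hi_at[OF that(2), rotated 2]) (use r D_less in linarith)+
    then have "t = t'" using r by linarith
    with i show ?thesis by simp
  qed
  have "t \<in> N \<and> t < 2 * p" if "tile x i t" for i t
    using that unfolding tile_def by blast
  with same show ?thesis unfolding skeleton_def by blast
qed

text \<open>Only some of the \<open>2 * p\<close> data symbols of a tile are cells. The number depends on whether the
  belt goes on, that is, whether the tile and its right neighbour are both link tiles.\<close>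

definition link :: "(int \<Rightarrow> nat \<Rightarrow> bool) \<Rightarrow> int \<Rightarrow> bool" where
  "link T i \<longleftrightarrow> (\<exists>t\<ge>p. T i t)"

definition cell :: "(int \<Rightarrow> nat \<Rightarrow> bool) \<Rightarrow> int \<Rightarrow> nat \<Rightarrow> bool" where
  "cell T i j \<longleftrightarrow> (\<exists>t. T i t \<and> j < (if t \<ge> p \<and> link T (i + L) then p else t))"

definition cells :: "(int \<Rightarrow> nat \<Rightarrow> bool) \<Rightarrow> int set" where
  "cells T = {q. \<exists>i j. cell T i j \<and> q = pos i j}"

definition nxt :: "(int \<Rightarrow> nat \<Rightarrow> bool) \<Rightarrow> int \<Rightarrow> int \<Rightarrow> bool" where
  "nxt T q q' \<longleftrightarrow> (\<exists>i j. q = pos i j \<and>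
      (cell T i (Suc j) \<and> q' = pos i (Suc j) \<or>
       Suc j = p \<and> link T i \<and> link T (i + L) \<and> q' = pos (i + L) 0))"

text \<open>Parity is read off inside the tile, so it is available without knowing where the belt starts.
  Since \<open>p\<close> is even, it alternates across tile boundaries too.\<close>

definition even_cell :: "(int \<Rightarrow> nat \<Rightarrow> bool) \<Rightarrow> int \<Rightarrow> bool" where
  "even_cell T q \<longleftrightarrow> (\<exists>i j. cell T i j \<and> q = pos i j \<and> even j)"

context
  fixes T assumes sk: "skeleton T"
begin

lemma type_bounds: "T i t \<Longrightarrow> t \<in> N \<and> t < 2 * p \<and> 3 \<le> t"
  using sk N_ge unfolding skeleton_def by blast

lemma type_unique: "T i t \<Longrightarrow> T i t' \<Longrightarrow> t = t'"
  using sk p_ge unfolding skeleton_def L_def by force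

lemma cell_imp_tile: "cell T i j \<Longrightarrow> \<exists>t. T i t \<and> j < 2 * p"
  unfolding cell_def using type_bounds p_ge by (fastforce split: if_splits)

lemma cell_0: "T i t \<Longrightarrow> cell T i 0"
  unfolding cell_def using type_bounds p_ge by fastforce

lemma pos_unique:
  assumes "pos i j = pos i' j'" "T i t" "T i' t'" "j < 2 * p" "j' < 2 * p"
  shows "i = i' \<and> j = j'"
proof -
  have "\<bar>i - i'\<bar> < L" using assms unfolding pos_def L_def by linarith
  then have "i = i'" using sk assms unfolding skeleton_def by blast
  with assms show ?thesis by (simp add: pos_def)
qed

lemma cell_pos_unique:
  assumes "pos i j = pos i' j'" "cell T i j" "cell T i' j'"
  shows "i = i' \<and> j = j'"
  using pos_unique[OF assms(1)] assms(2,3) cell_imp_tile by metis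

lemma nxt_cases:
  assumes "nxt T q q'"
  obtains (inner) i j where "q = pos i j" "q' = pos i (Suc j)" "cell T i j" "cell T i (Suc j)"
  | (across) i j where "q = pos i j" "q' = pos (i + L) 0" "Suc j = p" "link T i" "link T (i + L)"
      "cell T i j" "cell T (i + L) 0"
proof -
  from assms obtain i j where ij: "q = pos i j"
    "cell T i (Suc j) \<and> q' = pos i (Suc j) \<or>
       Suc j = p \<and> link T i \<and> link T (i + L) \<and> q' = pos (i + L) 0"
    unfolding nxt_def by blast
  from ij(2) show thesis
  proof
    assume *: "cell T i (Suc j) \<and> q' = pos i (Suc j)"
    then have "cell T i j" unfolding cell_def by (auto intro: Suc_lessD)
    with * ij show thesis using inner by blast
  next
    assume *: "Suc j = p \<and> link T i \<and> link T (i + L) \<and> q' = pos (i + L) 0"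
    then have "cell T i j" "cell T (i + L) 0"
      using cell_0 by (auto simp: cell_def link_def)
    with * ij show thesis using across by blast
  qed
qed

lemma nxt_in_cells: "nxt T q q' \<Longrightarrow> q \<in> cells T \<and> q' \<in> cells T"
  by (erule nxt_cases) (auto simp: cells_def)

lemma nxt_less: "nxt T q q' \<Longrightarrow> q < q' \<and> q' \<le> q + L"
  by (erule nxt_cases) (auto simp: pos_def L_def)

lemma nxt_kinds_exclusive:
  assumes "cell T i (Suc j)" "Suc j = p" "link T i" "link T (i + L)" shows False
proof -
  obtain t where t: "T i t" "Suc j < (if t \<ge> p \<and> link T (i + L) then p else t)"
    using assms(1) unfolding cell_def by blast
  obtain t' where "T i t'" "t' \<ge> p" using assms(3) unfolding link_def by blast
  then have "t \<ge> p" using type_unique[OF t(1)] by simp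
  then show False using t(2) assms(2,4) by simp
qed

lemma nxt_right_unique:
  assumes "nxt T q q1" "nxt T q q2" shows "q1 = q2"
  using assms(1)
proof (cases rule: nxt_cases)
  case 1: (inner i j)
  from assms(2) show ?thesis
  proof (cases rule: nxt_cases)
    case (inner i' j')
    then show ?thesis using cell_pos_unique[of i j i' j'] 1 by simp
  next
    case (across i' j')
    then show ?thesis using cell_pos_unique[of i j i' j'] nxt_kinds_exclusive[of i j] 1 by simp
  qed
next
  case 1: (across i j)
  from assms(2) show ?thesis
  proof (cases rule: nxt_cases)
    case (inner i' j')
    then show ?thesis using cell_pos_unique[of i j i' j'] nxt_kinds_exclusive[of i j] 1 by simp
  next
    case (across i' j')
    then show ?thesis using cell_pos_unique[of i j i' j'] 1 by simp
  qed
qed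

lemma nxt_left_unique:
  assumes "nxt T q1 q" "nxt T q2 q" shows "q1 = q2"
  using assms(1)
proof (cases rule: nxt_cases)
  case 1: (inner i j)
  from assms(2) show ?thesis
  proof (cases rule: nxt_cases)
    case (inner i' j')
    then show ?thesis using cell_pos_unique[of i "Suc j" i' "Suc j'"] 1 by simp
  next
    case (across i' j')
    then show ?thesis using cell_pos_unique[of i "Suc j" "i' + L" 0] 1 by simp
  qed
next
  case 1: (across i j)
  from assms(2) show ?thesis
  proof (cases rule: nxt_cases)
    case (inner i' j')
    then show ?thesis using cell_pos_unique[of i' "Suc j'" "i + L" 0] 1 by simp
  next
    case (across i' j')
    moreover have "i' = i" using 1 across cell_pos_unique[of "i' + L" 0 "i + L" 0] by simp
    moreover have "j' = j" using 1 across by simp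
    ultimately show ?thesis using 1 by simp
  qed
qed

lemma even_cell_pos: "cell T i j \<Longrightarrow> even_cell T (pos i j) \<longleftrightarrow> even j"
  unfolding even_cell_def using cell_pos_unique by blast

lemma even_cell_nxt: "nxt T q q' \<Longrightarrow> even_cell T q' \<longleftrightarrow> \<not> even_cell T q"
proof (erule nxt_cases)
  fix i j assume "q = pos i j" "q' = pos (i + L) 0" "Suc j = p" "cell T i j" "cell T (i + L) 0"
  then show ?thesis using even_cell_pos even_p by (metis even_Suc even_zero)
qed (simp add: even_cell_pos)

lemma first_cell:
  assumes "q \<in> cells T" "\<And>q'. \<not> nxt T q' q"
  obtains i t where "T i t" "q = pos i 0"
proof -
  obtain i j where ij: "cell T i j" "q = pos i j" using assms(1) unfolding cells_def by blast
  have "j = 0"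
  proof (cases j)
    case (Suc k)
    then have "nxt T (pos i k) q" using ij unfolding nxt_def by blast
    then show ?thesis using assms(2) by blast
  qed
  then show thesis using ij that cell_imp_tile by blast
qed

end

end

context belt_coding
begin

text \<open>The cells on a finite belt, in order, are \<open>c 0, \<dots>, c (n - 1)\<close>. A belt is a maximal chain of
  \<open>nxt\<close>, since its first cell has no predecessor and its last cell has no successor.\<close>

definition belt :: "(int \<Rightarrow> nat \<Rightarrow> bool) \<Rightarrow> (nat \<Rightarrow> int) \<Rightarrow> nat \<Rightarrow> bool" where
  "belt T c n \<longleftrightarrow> 0 < n \<and> c 0 \<in> cells T \<and> (\<forall>q. \<not> nxt T q (c 0)) \<and>
     (\<forall>m. Suc m < n \<longrightarrow> nxt T (c m) (c (Suc m))) \<and> (\<forall>q. \<not> nxt T (c (n - 1)) q)"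

context
  fixes T assumes sk: "skeleton T"
begin

lemma belt_cells:
  assumes "belt T c n" "m < n" shows "c m \<in> cells T"
proof (cases m)
  case 0
  then show ?thesis using assms unfolding belt_def by blast
next
  case (Suc k)
  then have "nxt T (c k) (c m)" using assms unfolding belt_def by blast
  then show ?thesis using nxt_in_cells[OF sk] by blast
qed

lemma belt_succ:
  assumes "belt T c n" "m < n" shows "nxt T (c m) q \<longleftrightarrow> Suc m < n \<and> q = c (Suc m)"
proof (cases "Suc m < n")
  case True
  then have "nxt T (c m) (c (Suc m))" using assms unfolding belt_def by blast
  then show ?thesis using True nxt_right_unique[OF sk] by blast
next
  case False
  then have "m = n - 1" using assms by simp
  then show ?thesis using False assms unfolding belt_def by blast
qed

lemma belt_pred:
  assumes "belt T c n" "m < n" shows "nxt T q (c m) \<longleftrightarrow> 0 < m \<and> q = c (m - 1)"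
proof (cases m)
  case 0
  then show ?thesis using assms unfolding belt_def by blast
next
  case (Suc k)
  then have "nxt T (c k) (c m)" using assms unfolding belt_def by blast
  then show ?thesis using Suc nxt_left_unique[OF sk] by auto
qed

lemma belt_strict_mono:
  assumes "belt T c n" "m < m'" "m' < n" shows "c m < c m'"
  using assms(2,3)
proof (induction m')
  case (Suc m')
  then have "c m' < c (Suc m')" 
    using assms(1) nxt_less[OF sk] unfolding belt_def by blast
  then show ?case using Suc by (cases "m = m'") auto
qed simp

lemma belt_inj:
  assumes "belt T c n" "m < n" "m' < n" "c m = c m'" shows "m = m'"
  using belt_strict_mono[OF assms(1)] assms(2-4) by (metis less_irrefl nat_neq_iff)

lemma belt_parity:
  assumes "belt T c n" "m < n" shows "even_cell T (c m) \<longleftrightarrow> even m"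
  using assms(2)
proof (induction m)
  case 0
  have "\<not> nxt T q (c 0)" for q using belt_pred[OF assms(1) 0] by simp
  then obtain i t where "T i t" "c 0 = pos i 0"
    using first_cell[OF sk] belt_cells[OF assms(1) 0] by blast
  then show ?case using even_cell_pos[OF sk] cell_0[OF sk] by simp
next
  case (Suc m)
  then have "nxt T (c m) (c (Suc m))" using assms(1) unfolding belt_def by blast
  then show ?case using even_cell_nxt[OF sk] Suc by simp
qed

lemma belt_inside_tile:
  assumes "belt T c n" "m < n" "c m = pos i 0" "cell T i j"
  shows "m + j < n \<and> c (m + j) = pos i j"
  using assms(4)
proof (induction j)
  case (Suc j)
  then have "cell T i j" unfolding cell_def by (auto intro: Suc_lessD)
  with Suc have IH: "m + j < n" "c (m + j) = pos i j" by auto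
  have "nxt T (c (m + j)) (pos i (Suc j))" unfolding IH nxt_def using Suc.prems by blast
  then show ?case using belt_succ[OF assms(1) IH(1)] by simp
qed (use assms in simp)

lemma belt_ends_in_tile:
  assumes b: "belt T c n" and m: "m < n" "c m = pos i 0"
    and T: "T i t" and last: "\<not> (t \<ge> p \<and> link T (i + L))"
  shows "n = m + t"
proof -
  have t: "3 \<le> t" using type_bounds[OF sk T] by simp
  then have "cell T i (t - 1)" unfolding cell_def using T last by (intro exI[of _ t]) auto
  then have at: "m + (t - 1) < n" "c (m + (t - 1)) = pos i (t - 1)" and cl: "cell T i (t - 1)"
    using belt_inside_tile[OF b m] by auto
  have "\<not> nxt T (pos i (t - 1)) q" for q
  proof
    assume "nxt T (pos i (t - 1)) q"
    then show False
    proof (cases rule: nxt_cases[OF sk, consumes 1, case_names inner across])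
      case (inner i' j')
      then have "cell T i t" using cell_pos_unique[OF sk inner(1) cl inner(3)] t by auto
      then show False unfolding cell_def using type_unique[OF sk T] last by auto
    next
      case (across i' j')
      then have "link T i" "link T (i + L)" 
        using cell_pos_unique[OF sk across(1) cl across(6)] by auto
      then show False using last type_unique[OF sk T] unfolding link_def by blast
    qed
  qed
  then have "\<not> Suc (m + (t - 1)) < n" using belt_succ[OF b at(1)] at(2) by metis
  then show ?thesis using at(1) t by simp
qed

lemma belt_crosses_tile:
  assumes b: "belt T c n" and m: "m < n" "c m = pos i 0"
    and T: "T i t" and link: "t \<ge> p" "link T (i + L)"
  shows "m + p < n \<and> c (m + p) = pos (i + L) 0"
proof -
  have "cell T i (p - 1)" unfolding cell_def using T link p_ge by (intro exI[of _ t]) auto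
  then have at: "m + (p - 1) < n" "c (m + (p - 1)) = pos i (p - 1)"
    using belt_inside_tile[OF b m] by auto
  have "nxt T (c (m + (p - 1))) (pos (i + L) 0)"
    unfolding at nxt_def using T link p_ge by (intro exI[of _ i] exI[of _ "p - 1"]) (auto simp: link_def)
  then show ?thesis using belt_succ[OF b at(1)] p_ge by (auto simp: Suc_diff_le)
qed

text \<open>Induction from the end of the belt. The last tile contributes its type, which lies in \<open>N\<close>;
  each earlier link tile adds \<open>p\<close>, and adding \<open>p\<close> to a number \<open>\<ge> p\<close> preserves membership in
  \<open>N\<close>.\<close>

lemma belt_tail_length:
  assumes b: "belt T c n" and "m < n" "c m = pos i 0" "T i t" "t \<ge> p"
  shows "n - m \<in> N \<and> p \<le> n - m"
  using assms(2-5)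
proof (induction "n - m" arbitrary: m i t rule: less_induct)
  case less
  show ?case
  proof (cases "link T (i + L)")
    case True
    then have next_tile: "m + p < n" "c (m + p) = pos (i + L) 0"
      using belt_crosses_tile[OF b less.prems] by auto
    obtain t' where "T (i + L) t'" "t' \<ge> p" using True unfolding link_def by blast
    then have "n - (m + p) \<in> N \<and> p \<le> n - (m + p)"
      using less.hyps[of "m + p"] next_tile p_ge less.prems(1) by simp
    moreover have "n - m = n - (m + p) + p" using next_tile by simp
    ultimately show ?thesis using N_period[of "n - (m + p)"] by simp
  next
    case False
    then have "n = m + t" using belt_ends_in_tile[OF b less.prems(1-3)] by blast
    then show ?thesis using type_bounds[OF sk less.prems(3)] less.prems(4) by simp
  qed
qed

lemma belt_first_tile:
  assumes "belt T c n" obtains i t where "T i t" "c 0 = pos i 0"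
proof -
  have "c 0 \<in> cells T" "\<And>q. \<not> nxt T q (c 0)" using assms unfolding belt_def by auto
  then show thesis using first_cell[OF sk] that by blast
qed

lemma belt_length_in_N:
  assumes "belt T c n" shows "n \<in> N"
proof -
  have n: "0 < n" using assms unfolding belt_def by blast
  obtain i t where it: "T i t" "c 0 = pos i 0" using belt_first_tile[OF assms] .
  show ?thesis
  proof (cases "t \<ge> p")
    case True
    then show ?thesis using belt_tail_length[OF assms n it(2,1)] by simp
  next
    case False
    then show ?thesis using belt_ends_in_tile[OF assms n it(2,1)] type_bounds[OF sk it(1)] by simp
  qed
qed

text \<open>When there are only finitely many cells, walking left along \<open>nxt\<close> reaches a first cell, and
  walking right from there reaches a last one, because \<open>nxt\<close> increases positions.\<close>

lemma cell_lies_on_belt: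
  assumes fin: "finite (cells T)" and q: "q \<in> cells T"
  obtains c n m where "belt T c n" "m < n" "c m = q"
proof -
  have "\<exists>q0 k. q0 \<in> cells T \<and> (\<forall>q'. \<not> nxt T q' q0) \<and> (nxt T ^^ k) q0 q"
    using q
  proof (induction "card {q' \<in> cells T. q' < q}" arbitrary: q rule: less_induct)
    case less
    show ?case
    proof (cases "\<exists>q'. nxt T q' q")
      case True
      then obtain q' where q': "nxt T q' q" by blast
      then have "q' \<in> cells T" "q' < q" using nxt_in_cells[OF sk] nxt_less[OF sk] by auto
      then have "{r \<in> cells T. r < q'} \<subset> {r \<in> cells T. r < q}" by auto
      then have "card {r \<in> cells T. r < q'} < card {r \<in> cells T. r < q}"
        using fin by (intro psubset_card_mono) auto
      then obtain q0 k where "q0 \<in> cells T" "\<forall>q'. \<not> nxt T q' q0" "(nxt T ^^ k) q0 q'"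
        using less.hyps \<open>q' \<in> cells T\<close> by blast
      then show ?thesis using q' by (intro exI[of _ q0] exI[of _ "Suc k"]) auto
    next
      case False
      then show ?thesis using less.prems by (intro exI[of _ q] exI[of _ 0]) auto
    qed
  qed
  then obtain q0 k where q0: "q0 \<in> cells T" "\<forall>q'. \<not> nxt T q' q0" "(nxt T ^^ k) q0 q" by blast
  \<comment> \<open>Follow successors from the first cell \<open>q0\<close>. The values after the last cell are arbitrary.\<close>
  define c where "c m = ((\<lambda>q. SOME q'. nxt T q q') ^^ m) q0" for m
  have c_Suc: "c (Suc m) = r" if "nxt T (c m) r" for m r
  proof -
    have "c (Suc m) = (SOME q'. nxt T (c m) q')" by (simp add: c_def)
    moreover have "nxt T (c m) (SOME q'. nxt T (c m) q')" using that by (rule someI)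
    ultimately show ?thesis using nxt_right_unique[OF sk that] by simp
  qed
  have path: "\<And>q. (nxt T ^^ k) q0 q \<Longrightarrow> c k = q \<and> (\<forall>j<k. \<exists>r. nxt T (c j) r)" for k
  proof (induction k)
    case 0
    then show ?case by (simp add: c_def)
  next
    case (Suc k)
    then obtain r where "(nxt T ^^ k) q0 r" "nxt T r q" by auto
    then show ?case using Suc.IH c_Suc by (metis less_Suc_eq)
  qed
  have "\<exists>m. \<forall>r. \<not> nxt T (c m) r"
  proof (rule ccontr)
    assume "\<not> ?thesis"
    then have step: "nxt T (c m) (c (Suc m))" for m using c_Suc by metis
    then have "strict_mono c" using nxt_less[OF sk] by (simp add: strict_mono_Suc_iff)
    then have "infinite (range c)" using strict_mono_imp_inj_on range_inj_infinite by blast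
    moreover have "range c \<subseteq> cells T" using step nxt_in_cells[OF sk] by blast
    ultimately show False using fin finite_subset by blast
  qed
  then obtain l where l: "\<forall>r. \<not> nxt T (c l) r" "\<And>m. m < l \<Longrightarrow> \<exists>r. nxt T (c m) r"
    using exists_least_iff[of "\<lambda>m. \<forall>r. \<not> nxt T (c m) r"] by blast
  have "nxt T (c m) (c (Suc m))" if "Suc m < Suc l" for m
    using l(2)[of m] that c_Suc by auto
  then have "belt T c (Suc l)"
    unfolding belt_def using q0 l(1) by (auto simp: c_def)
  moreover have "k < Suc l" using path[OF q0(3)] l(1) by (metis not_less_eq)
  ultimately show thesis using that path[OF q0(3)] by blast
qed

end

end

section \<open>Swapping neighbouring cells\<close>

text \<open>\<open>V\<close> marks the vertices of the path \<open>0, \<dots>, n - 1\<close> that are swapped with their right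
  neighbour.\<close>

definition path_swap :: "(nat \<Rightarrow> bool) \<Rightarrow> nat \<Rightarrow> nat \<Rightarrow> nat" where
  "path_swap V n m = (if V m \<and> Suc m < n then Suc m else if 0 < m \<and> V (m - 1) then m - 1 else m)"

lemma path_swap_less: "m < n \<Longrightarrow> path_swap V n m < n"
  unfolding path_swap_def by auto

lemma path_swap_path_swap:
  assumes "\<And>m. V m \<Longrightarrow> \<not> V (Suc m)" "m < n"
  shows "path_swap V n (path_swap V n m) = m"
  using assms unfolding path_swap_def by (cases m) auto

context belt_coding
begin

text \<open>The same rule on a skeleton: \<open>U\<close> marks the cells that are swapped with their successor on the
  belt. It makes sense on infinite belts as well, on which no numbering of the cells need exist.\<close>

definition partner :: "(int \<Rightarrow> nat \<Rightarrow> bool) \<Rightarrow> (int \<Rightarrow> bool) \<Rightarrow> int \<Rightarrow> int \<Rightarrow> bool" where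
  "partner T U q q' \<longleftrightarrow> nxt T q q' \<and> U q \<or> nxt T q' q \<and> U q'"

definition swap :: "(int \<Rightarrow> nat \<Rightarrow> bool) \<Rightarrow> (int \<Rightarrow> bool) \<Rightarrow> int \<Rightarrow> int" where
  "swap T U q = (if \<exists>q'. partner T U q q' then THE q'. partner T U q q' else q)"

context
  fixes T U
  assumes sk: "skeleton T" and alt: "\<And>q q'. nxt T q q' \<Longrightarrow> U q \<Longrightarrow> \<not> U q'"
begin

lemma partner_unique: "partner T U q q1 \<Longrightarrow> partner T U q q2 \<Longrightarrow> q1 = q2"
  unfolding partner_def using nxt_right_unique[OF sk] nxt_left_unique[OF sk] alt by blast

lemma swap_partner: "partner T U q q' \<Longrightarrow> swap T U q = q'"
  unfolding swap_def using partner_unique by (auto intro!: the_equality)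

lemma swap_swap: "swap T U (swap T U q) = q"
proof (cases "\<exists>q'. partner T U q q'")
  case True
  then obtain q' where q': "partner T U q q'" by blast
  then have "partner T U q' q" unfolding partner_def by blast
  then show ?thesis using q' swap_partner by simp
qed (simp add: swap_def)

lemma swap_in_cells_iff: "swap T U q \<in> cells T \<longleftrightarrow> q \<in> cells T"
proof (cases "\<exists>q'. partner T U q q'")
  case True
  then show ?thesis using swap_partner nxt_in_cells[OF sk] unfolding partner_def by blast
qed (simp add: swap_def)

lemma swap_outside: "q \<notin> cells T \<Longrightarrow> swap T U q = q"
  unfolding swap_def partner_def using nxt_in_cells[OF sk] by auto

text \<open>On a finite belt the swaps are those of the path, transported along the numbering of the
  cells. This links the local rule to the permutations of \<open>{..<n}\<close>.\<close>

lemma swap_on_belt: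
  assumes b: "belt T c n" and m: "m < n" and U: "\<And>m. m < n \<Longrightarrow> U (c m) \<longleftrightarrow> V m"
  shows "swap T U (c m) = c (path_swap V n m)"
proof -
  have U': "U (c (m - 1)) \<longleftrightarrow> V (m - 1)" using U[of "m - 1"] m by linarith
  have "partner T U (c m) q \<longleftrightarrow> V m \<and> Suc m < n \<and> q = c (Suc m) \<or> 0 < m \<and> V (m - 1) \<and> q = c (m - 1)" for q
    unfolding partner_def belt_succ[OF sk b m] belt_pred[OF sk b m]
    using U[OF m] U' by auto
  moreover have "\<not> (V m \<and> Suc m < n \<and> 0 < m \<and> V (m - 1))"
  proof
    assume *: "V m \<and> Suc m < n \<and> 0 < m \<and> V (m - 1)"
    then have "nxt T (c (m - 1)) (c m)" using belt_pred[OF sk b m] by simp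
    then show False using alt U[OF m] U' * by blast
  qed
  ultimately show ?thesis unfolding swap_def path_swap_def by auto
qed

end

end

section \<open>Local rules and the topology of the full shift\<close>

lemma continuous_map_from_full_shift:
  assumes "finite W" and into: "\<And>x. x \<in> topspace (full_shift \<Sigma>) \<Longrightarrow> h x \<in> \<Sigma>"
    and local: "\<And>x y. x \<in> topspace (full_shift \<Sigma>) \<Longrightarrow> y \<in> topspace (full_shift \<Sigma>) \<Longrightarrow>
      (\<And>k. k \<in> W \<Longrightarrow> x k = y k) \<Longrightarrow> h x = h y"
  shows "continuous_map (full_shift \<Sigma>) (discrete_topology \<Sigma>) h"
  unfolding continuous_map_def
proof (intro conjI allI impI)
  show "h \<in> topspace (full_shift \<Sigma>) \<rightarrow> topspace (discrete_topology \<Sigma>)"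
    using into by simp
  fix B assume "openin (discrete_topology \<Sigma>) B"
  show "openin (full_shift \<Sigma>) {x \<in> topspace (full_shift \<Sigma>). h x \<in> B}"
    unfolding full_shift_def openin_product_topology_alt
  proof (intro ballI)
    fix x assume "x \<in> {x \<in> topspace (product_topology (\<lambda>_::int. discrete_topology \<Sigma>) UNIV). h x \<in> B}"
    then have x: "x \<in> topspace (full_shift \<Sigma>)" "h x \<in> B" by (auto simp: full_shift_def)
    let ?C = "\<lambda>k. if k \<in> W then {x k} else \<Sigma>"
    have sub: "Pi\<^sub>E UNIV ?C \<subseteq> {y \<in> topspace (full_shift \<Sigma>). h y \<in> B}"
    proof
      fix y assume y: "y \<in> Pi\<^sub>E UNIV ?C"
      have y_in: "y k \<in> ?C k" for k by (rule PiE_mem[OF y UNIV_I])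
      have "y k \<in> \<Sigma>" for k
        using y_in[of k] x(1) by (auto simp: topspace_full_shift split: if_splits)
      then have y_top: "y \<in> topspace (full_shift \<Sigma>)" by (simp add: topspace_full_shift)
      have "x k = y k" if "k \<in> W" for k using y_in[of k] that by simp
      then have "h x = h y" using local[OF x(1) y_top] by blast
      with y_top x(2) show "y \<in> {y \<in> topspace (full_shift \<Sigma>). h y \<in> B}" by simp
    qed
    have "{k \<in> UNIV. ?C k \<noteq> topspace (discrete_topology \<Sigma>)} \<subseteq> W" by auto
    then have fin: "finite {k \<in> UNIV. ?C k \<noteq> topspace (discrete_topology \<Sigma>)}"
      using \<open>finite W\<close> finite_subset by blast
    have opn_at: "openin (discrete_topology \<Sigma>) (?C k)" and x_at: "x k \<in> ?C k" for k
      using x(1) by (auto simp: topspace_full_shift)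
    have opn: "\<forall>k\<in>UNIV. openin (discrete_topology \<Sigma>) (?C k)" using opn_at by blast
    have "x \<in> Pi\<^sub>E UNIV ?C" by (rule PiE_I, rule x_at, simp)
    with fin opn sub show "\<exists>U. finite {i \<in> UNIV. U i \<noteq> topspace (discrete_topology \<Sigma>)} \<and>
        (\<forall>i\<in>UNIV. openin (discrete_topology \<Sigma>) (U i)) \<and> x \<in> Pi\<^sub>E UNIV U \<and>
        Pi\<^sub>E UNIV U \<subseteq> {x \<in> topspace (product_topology (\<lambda>_. discrete_topology \<Sigma>) UNIV). h x \<in> B}"
      unfolding full_shift_def by (intro exI[of _ ?C] conjI)
  qed
qed

text \<open>A basic open set restricts finitely many coordinates, so all others may be replaced by \<open>lo\<close>.\<close>

lemma finite_support_dense: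
  assumes "openin (full_shift \<Sigma>) A" "x \<in> A" "lo \<in> \<Sigma>"
  obtains y where "y \<in> A" "finite {k. y k \<noteq> lo}"
proof -
  have top: "x \<in> topspace (full_shift \<Sigma>)" using assms openin_subset by blast
  obtain U where U: "finite {k \<in> UNIV. U k \<noteq> topspace (discrete_topology \<Sigma>)}"
    "x \<in> Pi\<^sub>E UNIV U" "Pi\<^sub>E UNIV U \<subseteq> A"
    using assms unfolding full_shift_def openin_product_topology_alt by blast
  let ?y = "\<lambda>k. if U k \<noteq> \<Sigma> then x k else lo"
  have "?y \<in> Pi\<^sub>E UNIV U" using U(2) assms(3) by auto
  moreover have "finite {k. ?y k \<noteq> lo}" by (rule finite_subset[OF _ U(1)]) auto
  ultimately show thesis using that U(3) by blast
qed

lemma ex_int_shift: "(\<exists>i::int. P (i + 1)) \<longleftrightarrow> (\<exists>i. P i)"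
  by (metis diff_add_cancel)

context belt_coding
begin

text \<open>The \<open>transfer\<close> lemmas say that a notion can be decided from the tiles in a bounded window, and
  the \<open>shifted\<close> lemmas that it is invariant under translation. The radii are generous multiples
  of \<open>L\<close>.\<close>

lemma cell_transfer:
  assumes "skeleton T" "\<And>k. \<bar>k - pos i j\<bar> \<le> 2 * L \<Longrightarrow> T k = T' k" "cell T i j"
  shows "cell T' i j"
proof -
  have "j < 2 * p" using cell_imp_tile assms by blast
  then have "T i = T' i" "T (i + L) = T' (i + L)"
    by (auto intro!: assms(2) simp: pos_def L_def D_def)
  then show ?thesis using assms(3) unfolding cell_def link_def by simp
qed

lemma nxt_transfer:
  assumes sk: "skeleton T" and T: "\<And>k. \<bar>k - q\<bar> \<le> 3 * L \<or> \<bar>k - q'\<bar> \<le> 3 * L \<Longrightarrow> T k = T' k"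
    and nxt: "nxt T q q'"
  shows "nxt T' q q'"
  using nxt
proof (cases rule: nxt_cases[OF sk, consumes 1, case_names inner across])
  case (inner i j)
  have "T k = T' k" if "\<bar>k - pos i (Suc j)\<bar> \<le> 2 * L" for k
    using T[of k] that unfolding inner(2) L_def by linarith
  then have "cell T' i (Suc j)" using cell_transfer[OF sk _ inner(4)] by blast
  then show ?thesis using inner unfolding nxt_def by blast
next
  case (across i j)
  have "q - i = 4 * int p + 2"
    using across(1) arg_cong[OF across(3), of int] by (simp add: pos_def D_def)
  then have "\<bar>i - q\<bar> \<le> 3 * L" "\<bar>i + L - q\<bar> \<le> 3 * L" by (simp_all add: L_def)
  then have "T i = T' i" "T (i + L) = T' (i + L)" using T by blast+
  then have "link T' i" "link T' (i + L)" using across unfolding link_def by auto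
  then show ?thesis using across unfolding nxt_def by blast
qed

lemma even_cell_transfer:
  assumes "skeleton T" "\<And>k. \<bar>k - q\<bar> \<le> 2 * L \<Longrightarrow> T k = T' k" "even_cell T q"
  shows "even_cell T' q"
  using assms cell_transfer unfolding even_cell_def by blast

lemma shifted_cell: "cell (\<lambda>i. T (i + 1)) i j \<longleftrightarrow> cell T (i + 1) j"
  unfolding cell_def link_def by (simp add: algebra_simps)

lemma shifted_nxt: "nxt (\<lambda>i. T (i + 1)) q q' \<longleftrightarrow> nxt T (q + 1) (q' + 1)"
proof -
  let ?P = "\<lambda>i. \<exists>j. q + 1 = pos i j \<and>
      (cell T i (Suc j) \<and> q' + 1 = pos i (Suc j) \<or>
       Suc j = p \<and> link T i \<and> link T (i + L) \<and> q' + 1 = pos (i + L) 0)"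
  have "nxt (\<lambda>i. T (i + 1)) q q' \<longleftrightarrow> (\<exists>i. ?P (i + 1))"
    unfolding nxt_def shifted_cell link_def by (simp add: pos_def algebra_simps)
  also have "\<dots> \<longleftrightarrow> (\<exists>i. ?P i)" by (rule ex_int_shift[of ?P])
  finally show ?thesis unfolding nxt_def .
qed

lemma shifted_even_cell: "even_cell (\<lambda>i. T (i + 1)) q \<longleftrightarrow> even_cell T (q + 1)"
proof -
  let ?P = "\<lambda>i. \<exists>j. cell T i j \<and> q + 1 = pos i j \<and> even j"
  have "even_cell (\<lambda>i. T (i + 1)) q \<longleftrightarrow> (\<exists>i. ?P (i + 1))"
    unfolding even_cell_def shifted_cell by (simp add: pos_def algebra_simps)
  also have "\<dots> \<longleftrightarrow> (\<exists>i. ?P i)" by (rule ex_int_shift[of ?P])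
  finally show ?thesis unfolding even_cell_def .
qed

text \<open>The conditions under which a rule \<open>W\<close> for marking cells induces an automorphism that swaps
  each marked cell with its successor: no two consecutive cells are marked, the mark of a cell on
  a belt depends only on its number as described by \<open>V\<close>, and \<open>W\<close> is local and translation
  invariant.\<close>

definition marking :: "((int \<Rightarrow> nat \<Rightarrow> bool) \<Rightarrow> int \<Rightarrow> bool) \<Rightarrow> (nat \<Rightarrow> bool) \<Rightarrow> bool" where
  "marking W V \<longleftrightarrow> (\<forall>m. V m \<longrightarrow> \<not> V (Suc m)) \<and>
     (\<forall>T q q'. skeleton T \<longrightarrow> nxt T q q' \<longrightarrow> W T q \<longrightarrow> \<not> W T q') \<and>
     (\<forall>T c n m. skeleton T \<longrightarrow> belt T c n \<longrightarrow> m < n \<longrightarrow> (W T (c m) \<longleftrightarrow> V m)) \<and>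
     (\<forall>T T' q. skeleton T \<longrightarrow> skeleton T' \<longrightarrow> (\<forall>k. \<bar>k - q\<bar> \<le> 6 * L \<longrightarrow> T k = T' k) \<longrightarrow>
        W T q \<longrightarrow> W T' q) \<and>
     (\<forall>T q. W (\<lambda>i. T (i + 1)) q \<longleftrightarrow> W T (q + 1))"

lemma markingI:
  assumes "\<And>m. V m \<Longrightarrow> \<not> V (Suc m)"
    and "\<And>T q q'. skeleton T \<Longrightarrow> nxt T q q' \<Longrightarrow> W T q \<Longrightarrow> \<not> W T q'"
    and "\<And>T c n m. skeleton T \<Longrightarrow> belt T c n \<Longrightarrow> m < n \<Longrightarrow> W T (c m) \<longleftrightarrow> V m"
    and "\<And>T T' q. skeleton T \<Longrightarrow> skeleton T' \<Longrightarrow> (\<And>k. \<bar>k - q\<bar> \<le> 6 * L \<Longrightarrow> T k = T' k) \<Longrightarrow>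
      W T q \<Longrightarrow> W T' q"
    and "\<And>T q. W (\<lambda>i. T (i + 1)) q \<longleftrightarrow> W T (q + 1)"
  shows "marking W V"
  unfolding marking_def using assms by blast

definition first :: "(int \<Rightarrow> nat \<Rightarrow> bool) \<Rightarrow> int \<Rightarrow> bool" where
  "first T q \<longleftrightarrow> (\<forall>q'. \<not> nxt T q' q)"

definition second :: "(int \<Rightarrow> nat \<Rightarrow> bool) \<Rightarrow> int \<Rightarrow> bool" where
  "second T q \<longleftrightarrow> (\<exists>q'. nxt T q' q \<and> first T q')"

lemma nxt_transfer_near:
  assumes "skeleton T" "\<And>k. \<bar>k - q\<bar> \<le> 4 * L \<Longrightarrow> T k = T' k" "nxt T q' q"
  shows "nxt T' q' q"
  by (rule nxt_transfer[OF assms(1) _ assms(3)])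
     (use nxt_less[OF assms(1,3)] L_def in \<open>auto intro!: assms(2)\<close>)

lemma first_transfer:
  assumes "skeleton T'" "\<And>k. \<bar>k - q\<bar> \<le> 4 * L \<Longrightarrow> T k = T' k" "first T q"
  shows "first T' q"
  using assms nxt_transfer_near[of T' q T] unfolding first_def by metis

lemma L_pos: "0 < L"
  by (simp add: L_def)

lemma marking_even: "marking even_cell even"
proof (rule markingI)
  fix T T' q assume *: "skeleton T" "\<And>k. \<bar>k - q\<bar> \<le> 6 * L \<Longrightarrow> T k = T' k" "even_cell T q"
  have "T k = T' k" if "\<bar>k - q\<bar> \<le> 2 * L" for k using *(2)[of k] that L_pos by linarith
  then show "even_cell T' q" using even_cell_transfer[OF *(1) _ *(3)] by blast
qed (simp_all add: even_cell_nxt belt_parity shifted_even_cell)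

lemma marking_odd: "marking (\<lambda>T q. \<not> even_cell T q) odd"
proof (rule markingI)
  fix T T' q assume *: "skeleton T'" "\<And>k. \<bar>k - q\<bar> \<le> 6 * L \<Longrightarrow> T k = T' k" "\<not> even_cell T q"
  have "T' k = T k" if "\<bar>k - q\<bar> \<le> 2 * L" for k
    using *(2)[of k, symmetric] that L_pos by linarith
  then show "\<not> even_cell T' q" using even_cell_transfer[OF *(1)] *(3) by blast
qed (simp_all add: even_cell_nxt belt_parity shifted_even_cell)

lemma first_on_belt:
  assumes "skeleton T" "belt T c n" "m < n" shows "first T (c m) \<longleftrightarrow> m = 0"
  unfolding first_def belt_pred[OF assms] by auto

lemma shifted_first: "first (\<lambda>i. T (i + 1)) q \<longleftrightarrow> first T (q + 1)"
  unfolding first_def shifted_nxt using ex_int_shift[of "\<lambda>q'. nxt T q' (q + 1)"] by blast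

lemma shifted_second: "second (\<lambda>i. T (i + 1)) q \<longleftrightarrow> second T (q + 1)"
  unfolding second_def shifted_nxt shifted_first
  by (rule ex_int_shift[of "\<lambda>q'. nxt T q' (q + 1) \<and> first T q'"])

lemma marking_first: "marking first (\<lambda>m. m = 0)"
proof (rule markingI)
  fix T T' q assume *: "skeleton T'" "\<And>k. \<bar>k - q\<bar> \<le> 6 * L \<Longrightarrow> T k = T' k" "first T q"
  have "T k = T' k" if "\<bar>k - q\<bar> \<le> 4 * L" for k using *(2)[of k] that L_pos by linarith
  then show "first T' q" using first_transfer[OF *(1) _ *(3)] by blast
next
  show "\<not> first T q'" if "nxt T q q'" for T q q' using that unfolding first_def by blast
qed (simp_all add: first_on_belt shifted_first)

lemma marking_second: "marking second (\<lambda>m. m = 1)"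
proof (rule markingI)
  fix T q q' assume sk: "skeleton T" and *: "nxt T q q'" "second T q"
  then obtain r where r: "nxt T r q" unfolding second_def by blast
  show "\<not> second T q'"
  proof
    assume "second T q'"
    then obtain r' where r': "nxt T r' q'" "first T r'" unfolding second_def by blast
    have "r' = q" using nxt_left_unique[OF sk r'(1) *(1)] .
    then show False using r r'(2) unfolding first_def by blast
  qed
next
  fix T c n m assume sk: "skeleton T" and b: "belt T c n" and m: "m < n"
  have "second T (c m) \<longleftrightarrow> 0 < m \<and> first T (c (m - 1))"
    unfolding second_def belt_pred[OF sk b m] by blast
  also have "\<dots> \<longleftrightarrow> m = 1" using first_on_belt[OF sk b, of "m - 1"] m by auto
  finally show "second T (c m) \<longleftrightarrow> m = 1" .
next
  fix T T' q assume sk: "skeleton T" "skeleton T'"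
    and eq: "\<And>k. \<bar>k - q\<bar> \<le> 6 * L \<Longrightarrow> T k = T' k" and "second T q"
  then obtain q' where q': "nxt T q' q" "first T q'" unfolding second_def by blast
  have near: "q' < q" "q \<le> q' + L" using nxt_less[OF sk(1) q'(1)] by auto
  have "T k = T' k" if "\<bar>k - q\<bar> \<le> 4 * L" for k using eq[of k] that L_pos by linarith
  then have "nxt T' q' q" using nxt_transfer_near[OF sk(1) _ q'(1)] by blast
  moreover have "T k = T' k" if "\<bar>k - q'\<bar> \<le> 4 * L" for k
    using eq[of k] that L_pos near by linarith
  then have "first T' q'" using first_transfer[OF sk(2) _ q'(2)] by blast
  ultimately show "second T' q" unfolding second_def by blast
qed (simp_all add: shifted_second)

lemma swap_near:
  assumes "skeleton T" "\<And>q q'. nxt T q q' \<Longrightarrow> U q \<Longrightarrow> \<not> U q'"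
  shows "\<bar>swap T U q - q\<bar> \<le> L"
proof (cases "\<exists>q'. partner T U q q'")
  case True
  then obtain q' where q': "partner T U q q'" by blast
  then have "\<bar>q' - q\<bar> \<le> L" using nxt_less[OF assms(1)] unfolding partner_def by fastforce
  then show ?thesis using swap_partner[OF assms q'] by simp
qed (simp add: swap_def L_def)

lemma partner_transfer:
  assumes "marking W V" "skeleton T" "skeleton T'" "\<And>k. \<bar>k - q\<bar> \<le> 7 * L \<Longrightarrow> T k = T' k"
    "partner T (W T) q q'"
  shows "partner T' (W T') q q'"
proof -
  have near: "\<bar>q - q'\<bar> \<le> L" using assms(5) nxt_less[OF assms(2)] unfolding partner_def by fastforce
  have T: "T k = T' k" if "\<bar>k - q\<bar> \<le> 3 * L \<or> \<bar>k - q'\<bar> \<le> 3 * L" for k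
    using assms(4)[of k] that near L_pos by linarith
  have nxt: "nxt T q q' \<Longrightarrow> nxt T' q q'" "nxt T q' q \<Longrightarrow> nxt T' q' q"
    using nxt_transfer[OF assms(2), of q q' T'] nxt_transfer[OF assms(2), of q' q T'] T by blast+
  have W: "W T r \<Longrightarrow> W T' r" if "\<bar>q - r\<bar> \<le> L" for r
  proof -
    have "T k = T' k" if "\<bar>k - r\<bar> \<le> 6 * L" for k
      using assms(4)[of k] that \<open>\<bar>q - r\<bar> \<le> L\<close> by linarith
    then show "W T r \<Longrightarrow> W T' r" using assms(1-3) unfolding marking_def by blast
  qed
  have "W T q \<Longrightarrow> W T' q" "W T q' \<Longrightarrow> W T' q'" using W near L_pos by simp_all
  with nxt show ?thesis using assms(5) unfolding partner_def by blast
qed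

lemma swap_local:
  assumes "marking W V" "skeleton T" "skeleton T'" "\<And>k. \<bar>k - q\<bar> \<le> 7 * L \<Longrightarrow> T k = T' k"
  shows "swap T (W T) q = swap T' (W T') q"
proof -
  have "T' k = T k" if "\<bar>k - q\<bar> \<le> 7 * L" for k using assms(4)[OF that] by simp
  then have "partner T (W T) q = partner T' (W T') q"
    using partner_transfer[OF assms(1-4)] partner_transfer[OF assms(1,3,2)] by blast
  then show ?thesis unfolding swap_def by (simp only:)
qed

lemma shifted_swap:
  assumes "marking W V" "skeleton T" "skeleton (\<lambda>i. T (i + 1))"
  shows "swap (\<lambda>i. T (i + 1)) (W (\<lambda>i. T (i + 1))) q = swap T (W T) (q + 1) - 1"
proof -
  let ?T = "\<lambda>i. T (i + 1)"
  have W: "W ?T q \<longleftrightarrow> W T (q + 1)" for q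
    using assms(1) unfolding marking_def by blast
  have eq: "partner ?T (W ?T) q q' \<longleftrightarrow> partner T (W T) (q + 1) (q' + 1)" for q'
    unfolding partner_def shifted_nxt W ..
  have alt: "nxt S q q' \<Longrightarrow> W S q \<Longrightarrow> \<not> W S q'" if "skeleton S" for S q q'
    using assms(1) that unfolding marking_def by blast
  show ?thesis
  proof (cases "\<exists>q'. partner T (W T) (q + 1) q'")
    case True
    then obtain q' where q': "partner T (W T) (q + 1) q'" by blast
    then have "partner ?T (W ?T) q (q' - 1)" unfolding eq by simp
    then show ?thesis
      using swap_partner[OF assms(2) alt[OF assms(2)] q'] swap_partner[OF assms(3) alt[OF assms(3)]]
      by simp
  next
    case False
    then show ?thesis unfolding swap_def eq by auto
  qed
qed

end

section \<open>Automorphisms swapping marked cells\<close>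

locale belt_shift = belt_coding p N hi lo for p N and hi lo :: 'a +
  fixes \<Sigma> :: "'a set"
  assumes hi_in: "hi \<in> \<Sigma>" and lo_in: "lo \<in> \<Sigma>"
begin

abbreviation "FS \<equiv> full_shift \<Sigma>"

lemma tile_cong:
  assumes "\<And>r. 0 \<le> r \<Longrightarrow> r < L \<Longrightarrow> x (i + r) = y (i + r)" "tile x i t"
  shows "tile y i t"
proof -
  have "if D \<le> r \<and> even r then y (i + r) \<in> {hi, lo}
      else y (i + r) = (if r < 2 \<or> r = 3 + int t then hi else lo)"
    if r: "0 \<le> r" "r < L" for r
    using assms(2) r unfolding tile_def assms(1)[OF r, symmetric] by blast
  then show ?thesis using assms(2) unfolding tile_def by blast
qed

lemma tile_first_hi: "tile x i t \<Longrightarrow> x i = hi"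
  unfolding tile_def L_def D_def by (auto dest!: spec[of _ 0])

lemma shifted_tile: "tile (shift x) = (\<lambda>i. tile x (i + 1))"
  unfolding tile_def shift_def by (intro ext) (simp add: algebra_simps)

lemma cell_value:
  assumes "q \<in> cells (tile x)" shows "x q \<in> {hi, lo}"
proof -
  obtain i j where ij: "cell (tile x) i j" "q = pos i j" using assms unfolding cells_def by blast
  then obtain t where t: "tile x i t" "j < 2 * p" using cell_imp_tile[OF skeleton_tile] by blast
  define r where "r = D + 2 * int j"
  have r: "0 \<le> r" "r < L" "D \<le> r \<and> even r" using t(2) by (auto simp: r_def L_def D_def)
  then have "x (i + r) \<in> {hi, lo}" using t(1) unfolding tile_def by (metis (no_types))
  then show ?thesis unfolding ij(2) pos_def r_def by (simp add: add.assoc)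
qed

text \<open>A position that is not a data position of the given tile is not one of any other tile either,
  because tiles are disjoint. So the fixed symbols of a tile are left alone.\<close>

lemma tile_persists:
  assumes off: "\<And>q. y q \<noteq> x q \<Longrightarrow> \<exists>i t j. tile x i t \<and> j < 2 * p \<and> q = pos i j"
    and on: "\<And>q. y q \<noteq> x q \<Longrightarrow> y q \<in> {hi, lo}"
    and t: "tile x i t"
  shows "tile y i t"
proof -
  have "if D \<le> r \<and> even r then y (i + r) \<in> {hi, lo}
      else y (i + r) = (if r < 2 \<or> r = 3 + int t then hi else lo)"
    if r: "0 \<le> r" "r < L" for r
  proof -
    have x: "if D \<le> r \<and> even r then x (i + r) \<in> {hi, lo}
      else x (i + r) = (if r < 2 \<or> r = 3 + int t then hi else lo)"
      using t r unfolding tile_def by blast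
    show ?thesis
    proof (cases "y (i + r) = x (i + r)")
      case True
      show ?thesis unfolding True by (rule x)
    next
      case False
      obtain i' t' j where ij: "tile x i' t'" "j < 2 * p" "i + r = pos i' j"
        using off[OF False] by blast
      have "\<bar>i - i'\<bar> < L" using ij(2,3) r unfolding pos_def L_def D_def by linarith
      then have "i = i'" using skeleton_tile t ij(1) unfolding skeleton_def by blast
      then have "r = D + 2 * int j" using ij(3) by (simp add: pos_def)
      then have "D \<le> r \<and> even r" by (simp add: D_def)
      then show ?thesis using on[OF False] by simp
    qed
  qed
  then show ?thesis using t unfolding tile_def by blast
qed

text \<open>The previous lemma shows that tiles of \<open>x\<close> are tiles of \<open>y\<close>. It then applies with \<open>x\<close> and
  \<open>y\<close> exchanged, since data positions of tiles of \<open>x\<close> are now data positions of tiles of \<open>y\<close>.\<close>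

lemma tile_unchanged:
  assumes off: "\<And>q. q \<notin> cells (tile x) \<Longrightarrow> y q = x q"
    and on: "\<And>q. q \<in> cells (tile x) \<Longrightarrow> y q \<in> {hi, lo}"
  shows "tile y = tile x"
proof -
  have cell: "q \<in> cells (tile x)" if "y q \<noteq> x q" for q
    by (rule ccontr) (use off[of q] that in simp)
  have off': "\<exists>i t j. tile x i t \<and> j < 2 * p \<and> q = pos i j" if "y q \<noteq> x q" for q
  proof -
    obtain i j where "cell (tile x) i j" "q = pos i j" using cell[OF \<open>y q \<noteq> x q\<close>] unfolding cells_def by blast
    then show ?thesis using cell_imp_tile[OF skeleton_tile] by blast
  qed
  have on': "y q \<in> {hi, lo}" if "y q \<noteq> x q" for q using on[OF cell[OF that]] .
  have xy: "tile y i t" if "tile x i t" for i t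
    by (rule tile_persists[OF off' on' that])
  have "\<exists>i t j. tile y i t \<and> j < 2 * p \<and> q = pos i j" if "x q \<noteq> y q" for q
    using off'[OF that[symmetric]] xy by blast
  moreover have "x q \<in> {hi, lo}" if "x q \<noteq> y q" for q
    using cell_value[OF cell[OF that[symmetric]]] .
  ultimately have yx: "tile x i t" if "tile y i t" for i t
    by (rule tile_persists[OF _ _ that])
  show ?thesis using xy yx by (intro ext iffI)
qed

text \<open>The rule is undefined outside the full shift, as elements of \<^const>\<open>Aut_full_shift\<close> have to
  be extensional.\<close>

definition marked_swap ::
    "((int \<Rightarrow> nat \<Rightarrow> bool) \<Rightarrow> int \<Rightarrow> bool) \<Rightarrow> (int \<Rightarrow> 'a) \<Rightarrow> (int \<Rightarrow> 'a)" where
  "marked_swap W = (\<lambda>x\<in>topspace FS. \<lambda>q. x (swap (tile x) (W (tile x)) q))"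

context
  fixes W V assumes W: "marking W V"
begin

lemma alternating: "skeleton T \<Longrightarrow> nxt T q q' \<Longrightarrow> W T q \<Longrightarrow> \<not> W T q'"
  using W unfolding marking_def by blast

lemma marked_swap_apply:
  "x \<in> topspace FS \<Longrightarrow> marked_swap W x = (\<lambda>q. x (swap (tile x) (W (tile x)) q))"
  unfolding marked_swap_def by simp

lemma marked_swap_in_topspace: "x \<in> topspace FS \<Longrightarrow> marked_swap W x \<in> topspace FS"
  by (simp add: marked_swap_apply topspace_full_shift)

lemma tile_marked_swap:
  assumes "x \<in> topspace FS" shows "tile (marked_swap W x) = tile x"
proof (rule tile_unchanged)
  fix q assume "q \<notin> cells (tile x)"
  then show "marked_swap W x q = x q"
    unfolding marked_swap_apply[OF assms]
    using swap_outside[OF skeleton_tile alternating[OF skeleton_tile]] by simp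
next
  fix q assume "q \<in> cells (tile x)"
  then have "swap (tile x) (W (tile x)) q \<in> cells (tile x)"
    using swap_in_cells_iff[OF skeleton_tile alternating[OF skeleton_tile]] by simp
  then show "marked_swap W x q \<in> {hi, lo}"
    unfolding marked_swap_apply[OF assms] by (rule cell_value)
qed

text \<open>The permutation of positions depends on the tiles only, and these are not changed. Hence the
  same permutation, which is an involution, is used both times.\<close>

lemma marked_swap_involution:
  assumes "x \<in> topspace FS" shows "marked_swap W (marked_swap W x) = x"
proof -
  have "marked_swap W (marked_swap W x) =
      (\<lambda>q. marked_swap W x (swap (tile x) (W (tile x)) q))"
    unfolding marked_swap_apply[OF marked_swap_in_topspace[OF assms]] tile_marked_swap[OF assms] ..
  also have "\<dots> = x"
    unfolding marked_swap_apply[OF assms]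
    using swap_swap[OF skeleton_tile alternating[OF skeleton_tile]] by simp
  finally show ?thesis .
qed

lemma marked_swap_shift:
  assumes "x \<in> topspace FS" shows "marked_swap W (shift x) = shift (marked_swap W x)"
proof
  fix q
  have sk: "skeleton (\<lambda>i. tile x (i + 1))" using skeleton_tile[of "shift x"] shifted_tile by metis
  have "marked_swap W (shift x) q = x (swap (tile x) (W (tile x)) (q + 1) - 1 + 1)"
    unfolding marked_swap_apply[OF shift_in_full_shift[OF assms]] shifted_tile
      shifted_swap[OF W skeleton_tile sk] by (simp add: shift_def)
  then show "marked_swap W (shift x) q = shift (marked_swap W x) q"
    unfolding marked_swap_apply[OF assms] by (simp add: shift_def)
qed

lemma marked_swap_local:
  assumes "x \<in> topspace FS" "y \<in> topspace FS" "\<And>k. k \<in> {q - 8 * L..q + 8 * L} \<Longrightarrow> x k = y k"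
  shows "marked_swap W x q = marked_swap W y q"
proof -
  have "tile x k t \<longleftrightarrow> tile y k t" if "\<bar>k - q\<bar> \<le> 7 * L" for k t
  proof -
    have "x (k + r) = y (k + r)" if "0 \<le> r" "r < L" for r
      using that \<open>\<bar>k - q\<bar> \<le> 7 * L\<close> by (intro assms(3)) auto
    then show ?thesis using tile_cong[of x k y] tile_cong[of y k x] by (metis (no_types))
  qed
  then have "tile x k = tile y k" if "\<bar>k - q\<bar> \<le> 7 * L" for k using that by blast
  then have "swap (tile x) (W (tile x)) q = swap (tile y) (W (tile y)) q"
    using swap_local[OF W skeleton_tile skeleton_tile] by blast
  moreover have "\<bar>swap (tile x) (W (tile x)) q - q\<bar> \<le> L"
    using swap_near[OF skeleton_tile alternating[OF skeleton_tile]] .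
  then have "x (swap (tile x) (W (tile x)) q) = y (swap (tile x) (W (tile x)) q)"
    using L_pos by (intro assms(3)) auto
  ultimately show ?thesis using assms(1,2) by (simp add: marked_swap_apply)
qed

lemma marked_swap_in_Aut: "marked_swap W \<in> carrier (Aut_full_shift \<Sigma>)"
proof -
  have "continuous_map FS (discrete_topology \<Sigma>) (\<lambda>x. marked_swap W x q)" for q
  proof (rule continuous_map_from_full_shift[of "{q - 8 * L..q + 8 * L}"])
    fix x assume "x \<in> topspace FS"
    then show "marked_swap W x q \<in> \<Sigma>"
      using marked_swap_in_topspace by (simp add: topspace_full_shift)
  qed (use marked_swap_local in blast)+
  then have "continuous_map FS FS (marked_swap W)"
    unfolding full_shift_def continuous_map_componentwise_UNIV by (simp add: full_shift_def[symmetric])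
  then have "homeomorphic_maps FS FS (marked_swap W) (marked_swap W)"
    using marked_swap_involution unfolding homeomorphic_maps_def by blast
  then have "homeomorphic_map FS FS (marked_swap W)"
    using homeomorphic_map_maps by blast
  moreover have "marked_swap W \<in> extensional (topspace FS)" unfolding marked_swap_def by simp
  ultimately show ?thesis using marked_swap_shift by (simp add: Aut_full_shift_def)
qed

end

section \<open>Permuting the cells of all belts\<close>

definition finsupp :: "(int \<Rightarrow> 'a) \<Rightarrow> bool" where
  "finsupp x \<longleftrightarrow> x \<in> topspace FS \<and> finite {q. x q \<noteq> lo}"

text \<open>The symbol in cell \<open>m\<close> of a belt of length \<open>n\<close> moves to cell \<open>\<sigma> n m\<close>. Only configurations of
  finite support are considered, since infinite belts carry no corresponding permutation.\<close>

definition acts :: "(nat \<Rightarrow> nat \<Rightarrow> nat) \<Rightarrow> ((int \<Rightarrow> 'a) \<Rightarrow> (int \<Rightarrow> 'a)) \<Rightarrow> bool" where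
  "acts \<sigma> f \<longleftrightarrow> (\<forall>n\<in>N. bij_betw (\<sigma> n) {..<n} {..<n}) \<and>
     (\<forall>x. finsupp x \<longrightarrow> (\<forall>q. q \<notin> cells (tile x) \<longrightarrow> f x q = x q) \<and>
        (\<forall>c n m. belt (tile x) c n \<longrightarrow> m < n \<longrightarrow> f x (c (\<sigma> n m)) = x (c m)))"

lemma acts_bij: "acts \<sigma> f \<Longrightarrow> n \<in> N \<Longrightarrow> bij_betw (\<sigma> n) {..<n} {..<n}"
  unfolding acts_def by blast

lemma acts_less: "acts \<sigma> f \<Longrightarrow> n \<in> N \<Longrightarrow> m < n \<Longrightarrow> \<sigma> n m < n"
  using bij_betwE[OF acts_bij] by (metis lessThan_iff)

lemma acts_off_cells: "acts \<sigma> f \<Longrightarrow> finsupp x \<Longrightarrow> q \<notin> cells (tile x) \<Longrightarrow> f x q = x q"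
  unfolding acts_def by blast

lemma acts_on_belt:
  "acts \<sigma> f \<Longrightarrow> finsupp x \<Longrightarrow> belt (tile x) c n \<Longrightarrow> m < n \<Longrightarrow> f x (c (\<sigma> n m)) = x (c m)"
  unfolding acts_def by blast

lemma finite_cells:
  assumes "finsupp x" shows "finite (cells (tile x))"
proof -
  have "cells (tile x) \<subseteq> (\<lambda>(i, j). pos i j) ` ({i. x i \<noteq> lo} \<times> {..<2 * p})"
  proof
    fix q assume "q \<in> cells (tile x)"
    then obtain i j where ij: "cell (tile x) i j" "q = pos i j" unfolding cells_def by blast
    then obtain t where t: "tile x i t" "j < 2 * p" using cell_imp_tile[OF skeleton_tile] by blast
    have "x i \<noteq> lo" using tile_first_hi[OF t(1)] hi_neq_lo by simp
    then show "q \<in> (\<lambda>(i, j). pos i j) ` ({i. x i \<noteq> lo} \<times> {..<2 * p})" using t(2) ij(2) by auto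
  qed
  moreover have "finite ({i. x i \<noteq> lo} \<times> {..<2 * p})" using assms unfolding finsupp_def by simp
  ultimately show ?thesis using finite_surj by blast
qed

lemma acts_cell:
  assumes f: "acts \<sigma> f" and x: "finsupp x" and q: "q \<in> cells (tile x)"
  obtains c n m where "belt (tile x) c n" "n \<in> N" "m < n" "q = c (\<sigma> n m)" "f x q = x (c m)"
proof -
  obtain c n m where cnm: "belt (tile x) c n" "m < n" "c m = q"
    using cell_lies_on_belt[OF skeleton_tile finite_cells[OF x] q] .
  have n: "n \<in> N" using belt_length_in_N[OF skeleton_tile cnm(1)] .
  have "m \<in> \<sigma> n ` {..<n}"
    using cnm(2) unfolding bij_betw_imp_surj_on[OF acts_bij[OF f n]] by simp
  then obtain m' where m': "m' < n" "\<sigma> n m' = m" by auto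
  have "f x (c (\<sigma> n m')) = x (c m')" using acts_on_belt[OF f x cnm(1) m'(1)] .
  then show thesis using that[OF cnm(1) n m'(1)] cnm(3) m'(2) by simp
qed

lemma recolour_cells:
  assumes x: "finsupp x" and off: "\<And>q. q \<notin> cells (tile x) \<Longrightarrow> y q = x q"
    and on: "\<And>q. q \<in> cells (tile x) \<Longrightarrow> y q \<in> {hi, lo}"
  shows "finsupp y" "tile y = tile x"
proof -
  have "{q. y q \<noteq> lo} \<subseteq> {q. x q \<noteq> lo} \<union> cells (tile x)" using off by auto
  then have "finite {q. y q \<noteq> lo}"
    using x finite_cells[OF x] unfolding finsupp_def by (meson finite_UnI finite_subset)
  moreover have "y q \<in> \<Sigma>" for q
  proof (cases "q \<in> cells (tile x)")
    case True
    then show ?thesis using on[OF True] hi_in lo_in by auto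
  next
    case False
    then show ?thesis using off[OF False] x unfolding finsupp_def topspace_full_shift by simp
  qed
  ultimately show "finsupp y" unfolding finsupp_def topspace_full_shift by simp
  show "tile y = tile x" using off on by (rule tile_unchanged)
qed

text \<open>All cells of \<open>f x\<close> contain symbols taken from cells of \<open>x\<close>, and elsewhere \<open>f x\<close> and \<open>x\<close>
  agree. This is what allows automorphisms of this kind to be composed.\<close>

lemma acts_preserves:
  assumes f: "acts \<sigma> f" and x: "finsupp x"
  shows "finsupp (f x)" "tile (f x) = tile x"
proof -
  have on: "f x q \<in> {hi, lo}" if q: "q \<in> cells (tile x)" for q
  proof -
    obtain c n m where cnm: "belt (tile x) c n" "m < n" "f x q = x (c m)"
      using acts_cell[OF f x q] by blast
    show ?thesis
      unfolding cnm(3) by (rule cell_value[OF belt_cells[OF skeleton_tile cnm(1,2)]])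
  qed
  show "finsupp (f x)" by (rule recolour_cells(1)[OF x acts_off_cells[OF f x] on])
  show "tile (f x) = tile x" by (rule recolour_cells(2)[OF x acts_off_cells[OF f x] on])
qed

lemma acts_marked_swap:
  assumes W: "marking W V" shows "acts (path_swap V) (marked_swap W)"
  unfolding acts_def
proof (intro conjI ballI allI impI)
  have V: "\<not> V (Suc m)" if "V m" for m using W that unfolding marking_def by blast
  show "bij_betw (path_swap V n) {..<n} {..<n}" for n
    by (rule bij_betw_byWitness[where f' = "path_swap V n"])
       (use path_swap_path_swap[of V, OF V] path_swap_less in auto)
  fix x assume x: "finsupp x"
  then have top: "x \<in> topspace FS" unfolding finsupp_def by blast
  show "marked_swap W x q = x q" if "q \<notin> cells (tile x)" for q
    unfolding marked_swap_apply[OF W top]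
    using swap_outside[OF skeleton_tile alternating[OF W skeleton_tile] that] by simp
  fix c n m assume b: "belt (tile x) c n" and m: "m < n"
  have mark: "W (tile x) (c m) \<longleftrightarrow> V m" if "m < n" for m
    using W skeleton_tile b that unfolding marking_def by blast
  have sw: "swap (tile x) (W (tile x)) (c (path_swap V n m)) = c (path_swap V n (path_swap V n m))"
    by (rule swap_on_belt[where T = "tile x" and U = "W (tile x)" and V = V and c = c,
          OF skeleton_tile alternating[OF W skeleton_tile] b path_swap_less[OF m] mark])
  show "marked_swap W x (c (path_swap V n m)) = x (c m)"
    unfolding marked_swap_apply[OF W top] sw using path_swap_path_swap[of V m n] V m by simp
qed

lemma acts_compose:
  assumes f: "acts \<sigma> f" and g: "acts \<tau> g"
  shows "acts (\<lambda>n. \<sigma> n \<circ> \<tau> n) (compose (topspace FS) f g)"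
  unfolding acts_def
proof (intro conjI ballI allI impI)
  fix n assume "n \<in> N"
  then show "bij_betw (\<sigma> n \<circ> \<tau> n) {..<n} {..<n}"
    by (intro bij_betw_trans[OF acts_bij[OF g] acts_bij[OF f]])
next
  fix x assume x: "finsupp x"
  then have eq: "compose (topspace FS) f g x = f (g x)"
    unfolding finsupp_def by (simp add: compose_eq)
  note gx = acts_preserves[OF g x]
  show "compose (topspace FS) f g x q = x q" if "q \<notin> cells (tile x)" for q
  proof -
    have "f (g x) q = g x q" using acts_off_cells[OF f gx(1)] gx(2) that by simp
    also have "\<dots> = x q" using acts_off_cells[OF g x that] .
    finally show ?thesis unfolding eq .
  qed
  fix c n m assume b: "belt (tile x) c n" and m: "m < n"
  have "\<tau> n m < n" using acts_less[OF g belt_length_in_N[OF skeleton_tile b] m] .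
  then have "f (g x) (c (\<sigma> n (\<tau> n m))) = g x (c (\<tau> n m))"
    using acts_on_belt[OF f gx(1)] gx(2) b by simp
  also have "\<dots> = x (c m)" using acts_on_belt[OF g x b m] .
  finally show "compose (topspace FS) f g x (c ((\<sigma> n \<circ> \<tau> n) m)) = x (c m)" unfolding eq by simp
qed

text \<open>On configurations of finite support, \<open>f\<close> is the identity, since every position is either
  outside the cells or on some finite belt. Continuity and density do the rest.\<close>

lemma Aut_eq_one_if_acts_trivially:
  assumes f: "f \<in> carrier (Aut_full_shift \<Sigma>)" "acts \<sigma> f"
    and triv: "\<And>n m. n \<in> N \<Longrightarrow> m < n \<Longrightarrow> \<sigma> n m = m"
  shows "f = (\<lambda>x\<in>topspace FS. x)"
proof (rule extensionalityI)
  have fixes_finsupp: "f x = x" if x: "finsupp x" for x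
  proof
    fix q show "f x q = x q"
    proof (cases "q \<in> cells (tile x)")
      case True
      then obtain c n m where "belt (tile x) c n" "n \<in> N" "m < n" "q = c (\<sigma> n m)" "f x q = x (c m)"
        using acts_cell[OF f(2) x] by blast
      then show ?thesis using triv by simp
    next
      case False
      then show ?thesis by (rule acts_off_cells[OF f(2) x])
    qed
  qed
  show "f \<in> extensional (topspace FS)" using f(1) by (simp add: Aut_full_shift_def)
  have cont: "continuous_map FS FS f"
    using f(1) homeomorphic_imp_continuous_map by (auto simp: Aut_full_shift_def)
  fix x assume x: "x \<in> topspace FS"
  have "f x q = x q" for q
  proof -
    have c1: "continuous_map FS (discrete_topology \<Sigma>) (\<lambda>y. f y q)"
      using cont unfolding full_shift_def continuous_map_componentwise_UNIV by blast
    have c2: "continuous_map FS (discrete_topology \<Sigma>) (\<lambda>y. y q)"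
      unfolding full_shift_def by (rule continuous_map_product_projection) simp
    have "f x q \<in> \<Sigma>" "x q \<in> \<Sigma>"
      using x cont unfolding continuous_map_def topspace_full_shift by blast+
    then have "openin FS {y \<in> topspace FS. f y q \<in> {f x q}}" "openin FS {y \<in> topspace FS. y q \<in> {x q}}"
      using openin_continuous_map_preimage[OF c1, of "{f x q}"]
        openin_continuous_map_preimage[OF c2, of "{x q}"] by simp_all
    then have "openin FS ({y \<in> topspace FS. f y q \<in> {f x q}} \<inter> {y \<in> topspace FS. y q \<in> {x q}})"
      by (rule openin_Int)
    then obtain y where y: "y \<in> {y \<in> topspace FS. f y q \<in> {f x q}} \<inter> {y \<in> topspace FS. y q \<in> {x q}}"
      "finite {k. y k \<noteq> lo}"
      using finite_support_dense[of \<Sigma> _ x] x lo_in by blast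
    then have "f y = y" using fixes_finsupp[of y] unfolding finsupp_def by blast
    then show ?thesis using y by auto
  qed
  then show "f x = (\<lambda>x\<in>topspace FS. x) x" using x by auto
qed simp

lemma N_decompose:
  assumes "v \<in> N" obtains k t where "v = k * p + t" "t \<in> N" "t < 2 * p" "0 < k \<longrightarrow> p \<le> t"
proof -
  have "\<exists>k t. v = k * p + t \<and> t \<in> N \<and> t < 2 * p \<and> (0 < k \<longrightarrow> p \<le> t)"
    using assms
  proof (induction v rule: less_induct)
    case (less v)
    show ?case
    proof (cases "v < 2 * p")
      case True
      then show ?thesis using less.prems by (intro exI[of _ 0] exI[of _ v]) simp
    next
      case False
      then have "v - p \<in> N" using N_period[of "v - p"] less.prems by simp
      then obtain k t where "v - p = k * p + t" "t \<in> N" "t < 2 * p" "0 < k \<longrightarrow> p \<le> t"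
        using less.IH[of "v - p"] False p_ge by auto
      moreover from this have "v = Suc k * p + t" "p \<le> t" using False by (cases k; simp)+
      ultimately show ?thesis by blast
    qed
  qed
  then show thesis using that by blast
qed

text \<open>With \<open>v = k * p + t\<close> as in the previous lemma, \<open>k + 1\<close> adjacent tiles of type \<open>t\<close> form a belt
  of length \<open>v\<close>: the first \<open>k\<close> of them contribute \<open>p\<close> cells each and the last one \<open>t\<close> cells.\<close>

lemma belt_of_each_length:
  assumes "v \<in> N" obtains x c where "finsupp x" "belt (tile x) c v"
proof -
  obtain k t where kt: "v = k * p + t" "t \<in> N" "t < 2 * p" "0 < k \<longrightarrow> p \<le> t"
    using N_decompose[OF assms] .
  define x where "x q = (if 0 \<le> q \<and> q < L * (int k + 1) \<and> (q mod L < 2 \<or> q mod L = 3 + int t)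
    then hi else lo)" for q
  have supp: "finite {q. x q \<noteq> lo}"
    by (rule finite_subset[of _ "{0..L * (int k + 1)}"]) (auto simp: x_def)
  then have x: "finsupp x" using hi_in lo_in unfolding finsupp_def topspace_full_shift x_def by auto
  have tile: "tile x (L * int a) t" if "a \<le> k" for a
  proof -
    have "x (L * int a + r) = (if r < 2 \<or> r = 3 + int t then hi else lo)" if r: "0 \<le> r" "r < L" for r
    proof -
      have "L * int a + r < L * int a + L * 1" using r by simp
      also have "\<dots> \<le> L * (int k + 1)" using \<open>a \<le> k\<close> L_pos unfolding distrib_left[symmetric]
        by (intro mult_left_mono) auto
      finally have "0 \<le> L * int a + r" "L * int a + r < L * (int k + 1)" using r L_pos by simp_all
      moreover have "(L * int a + r) mod L = r" using r by simp
      ultimately show ?thesis unfolding x_def by simp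
    qed
    then show ?thesis unfolding tile_def using kt(2,3) by auto
  qed
  \<comment> \<open>All symbols to the left of the tiles and to the right of them are \<open>lo\<close>, so the chain of tiles
    cannot be extended.\<close>
  have not_before: "\<not> tile x i s" if "i < 0" for i s
    using tile_first_hi[of x i s] that hi_neq_lo by (auto simp: x_def)
  have not_after: "\<not> tile x (L * int k + L) s" for s
    using tile_first_hi[of x "L * int k + L" s] hi_neq_lo by (auto simp: x_def algebra_simps)
  have tile0: "tile x 0 t" using tile[of 0] by simp
  note sk = skeleton_tile[of x]
  have "cell (tile x) 0 0" using cell_0[OF sk tile0] .
  then obtain c n m where b: "belt (tile x) c n" and m: "m < n" "c m = pos 0 0"
    using cell_lies_on_belt[OF sk finite_cells[OF x], of "pos 0 0"] unfolding cells_def by blast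
  have "\<not> nxt (tile x) q (pos 0 0)" for q
  proof
    assume "nxt (tile x) q (pos 0 0)"
    then show False
    proof (cases rule: nxt_cases[OF sk, consumes 1, case_names inner across])
      case (inner i j)
      then show False using cell_pos_unique[OF sk inner(2) \<open>cell (tile x) 0 0\<close> inner(4)] by simp
    next
      case (across i j)
      have "0 = i + L" using cell_pos_unique[OF sk across(2) \<open>cell (tile x) 0 0\<close> across(7)] by simp
      then have "i < 0" using L_pos by linarith
      then show False using not_before across(4) unfolding link_def by blast
    qed
  qed
  then have "m = 0" using belt_pred[OF sk b m(1)] m(2) by (metis neq0_conv)
  have reach: "a * p < n \<and> c (a * p) = pos (L * int a) 0" if "a \<le> k" for a
    using that
  proof (induction a)
    case 0
    then show ?case using m \<open>m = 0\<close> by simp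
  next
    case (Suc a)
    have "link (tile x) (L * int a + L)"
      using tile[OF Suc.prems] kt(4) Suc.prems unfolding link_def by (auto simp: algebra_simps)
    then have "a * p + p < n \<and> c (a * p + p) = pos (L * int a + L) 0"
      using belt_crosses_tile[OF sk b _ _ tile[of a]] Suc kt(4) by simp
    then show ?case by (simp add: algebra_simps)
  qed
  have "n = k * p + t"
    using belt_ends_in_tile[OF sk b _ _ tile[of k]] reach[of k] not_after unfolding link_def by blast
  then show thesis using that x b kt(1) by blast
qed

text \<open>To see where cell \<open>m\<close> is sent, make it the only cell containing \<open>hi\<close>.\<close>

lemma trivial_if_acts_by_identity:
  assumes "acts \<sigma> (\<lambda>x\<in>topspace FS. x)" "v \<in> N" "m < v"
  shows "\<sigma> v m = m"
proof -
  obtain x c where x: "finsupp x" "belt (tile x) c v" using belt_of_each_length[OF assms(2)] .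
  define y where "y q = (if q = c m then hi else if q \<in> cells (tile x) then lo else x q)" for q
  have cm: "c m \<in> cells (tile x)" using belt_cells[OF skeleton_tile x(2) assms(3)] .
  have "y q = x q" if "q \<notin> cells (tile x)" for q using that cm by (auto simp: y_def)
  moreover have "y q \<in> {hi, lo}" if "q \<in> cells (tile x)" for q using that by (simp add: y_def)
  ultimately have y: "finsupp y" "tile y = tile x"
    using recolour_cells(1)[OF x(1), of y] recolour_cells(2)[OF x(1), of y] by blast+
  have s: "\<sigma> v m < v" using acts_less[OF assms] .
  have "y \<in> topspace FS" using y(1) unfolding finsupp_def by blast
  moreover have "belt (tile y) c v" unfolding y(2) by (rule x(2))
  ultimately have "y (c (\<sigma> v m)) = y (c m)"
    using acts_on_belt[OF assms(1) y(1) _ assms(3)] by simp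
  then have "y (c (\<sigma> v m)) = hi" by (simp add: y_def)
  moreover have "c (\<sigma> v m) \<in> cells (tile x)" using belt_cells[OF skeleton_tile x(2) s] .
  ultimately have "c (\<sigma> v m) = c m" using hi_neq_lo by (auto simp: y_def split: if_splits)
  then show ?thesis using belt_inj[OF skeleton_tile x(2) s assms(3)] by blast
qed

end

section \<open>The generalized Neumann group\<close>

text \<open>A subgroup of a direct product that meets both factors trivially is the graph of an
  isomorphism between its two projections.\<close>

lemma mon_from_correspondence:
  assumes P: "group P" and Q: "group Q" and R: "subgroup R (P \<times>\<times> Q)"
    and left: "\<And>q. (\<one>\<^bsub>P\<^esub>, q) \<in> R \<Longrightarrow> q = \<one>\<^bsub>Q\<^esub>"
    and right: "\<And>g. (g, \<one>\<^bsub>Q\<^esub>) \<in> R \<Longrightarrow> g = \<one>\<^bsub>P\<^esub>"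
    and S: "S \<subseteq> fst ` R"
  shows "mon (subgroup_generated P S) Q \<noteq> {}"
proof -
  interpret P: group P by (rule P)
  interpret Q: group Q by (rule Q)
  interpret PQ: group "P \<times>\<times> Q" by (rule DirProd_group[OF P Q])
  have carrier: "g \<in> carrier P" "q \<in> carrier Q" if "(g, q) \<in> R" for g q
    using subgroup.mem_carrier[OF R that] by auto
  have mult: "(g \<otimes>\<^bsub>P\<^esub> h, q \<otimes>\<^bsub>Q\<^esub> r) \<in> R" if "(g, q) \<in> R" "(h, r) \<in> R" for g h q r
    using subgroup.m_closed[OF R that] by simp
  have inv: "(inv\<^bsub>P\<^esub> g, inv\<^bsub>Q\<^esub> q) \<in> R" if "(g, q) \<in> R" for g q
    using subgroup.m_inv_closed[OF R that] inv_DirProd[OF P Q carrier[OF that]] by simp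
  have right_unique: "q = r" if "(g, q) \<in> R" "(g, r) \<in> R" for g q r
  proof -
    have "(\<one>\<^bsub>P\<^esub>, q \<otimes>\<^bsub>Q\<^esub> inv\<^bsub>Q\<^esub> r) \<in> R" using mult[OF that(1) inv[OF that(2)]] carrier[OF that(1)] by simp
    then have "q \<otimes>\<^bsub>Q\<^esub> inv\<^bsub>Q\<^esub> r = \<one>\<^bsub>Q\<^esub>" by (rule left)
    from Q.inv_equality[OF this] show ?thesis using carrier[OF that(1)] carrier[OF that(2)] by simp
  qed
  have left_unique: "g = h" if "(g, q) \<in> R" "(h, q) \<in> R" for g h q
  proof -
    have "(g \<otimes>\<^bsub>P\<^esub> inv\<^bsub>P\<^esub> h, \<one>\<^bsub>Q\<^esub>) \<in> R" using mult[OF that(1) inv[OF that(2)]] carrier[OF that(1)] by simp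
    then have "g \<otimes>\<^bsub>P\<^esub> inv\<^bsub>P\<^esub> h = \<one>\<^bsub>P\<^esub>" by (rule right)
    from P.inv_equality[OF this] show ?thesis using carrier[OF that(1)] carrier[OF that(2)] by simp
  qed
  have "subgroup (fst ` R) P"
  proof (rule P.subgroupI)
    show "fst ` R \<subseteq> carrier P" using carrier by auto
    show "fst ` R \<noteq> {}" using subgroup.one_closed[OF R] by blast
    show "inv\<^bsub>P\<^esub> g \<in> fst ` R" if "g \<in> fst ` R" for g
    proof -
      obtain q where "(g, q) \<in> R" using \<open>g \<in> fst ` R\<close> by auto
      from inv[OF this] show ?thesis by force
    qed
    show "g \<otimes>\<^bsub>P\<^esub> h \<in> fst ` R" if "g \<in> fst ` R" "h \<in> fst ` R" for g h
    proof -
      obtain q r where "(g, q) \<in> R" "(h, r) \<in> R"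
        using \<open>g \<in> fst ` R\<close> \<open>h \<in> fst ` R\<close> by auto
      from mult[OF this] show ?thesis by force
    qed
  qed
  then have "generate P (carrier P \<inter> S) \<subseteq> fst ` R"
    using S by (intro P.generate_subgroup_incl) auto
  then have gen: "\<exists>q. (g, q) \<in> R" if "g \<in> carrier (subgroup_generated P S)" for g
    using that by (force simp: carrier_subgroup_generated)
  define \<phi> where "\<phi> g = (THE q. (g, q) \<in> R)" for g
  have \<phi>: "\<phi> g = q" if "(g, q) \<in> R" for g q
    unfolding \<phi>_def using that right_unique by blast
  have \<phi>_R: "(g, \<phi> g) \<in> R" if "g \<in> carrier (subgroup_generated P S)" for g
    using gen[OF that] \<phi> by metis
  have "\<phi> \<in> hom (subgroup_generated P S) Q"
  proof (rule homI)
    fix g assume "g \<in> carrier (subgroup_generated P S)"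
    then show "\<phi> g \<in> carrier Q" using \<phi>_R carrier(2) by blast
  next
    fix g h assume "g \<in> carrier (subgroup_generated P S)" "h \<in> carrier (subgroup_generated P S)"
    from \<phi>[OF mult[OF this[THEN \<phi>_R]]]
    show "\<phi> (g \<otimes>\<^bsub>subgroup_generated P S\<^esub> h) = \<phi> g \<otimes>\<^bsub>Q\<^esub> \<phi> h" by simp
  qed
  moreover have "inj_on \<phi> (carrier (subgroup_generated P S))"
  proof (rule inj_onI)
    fix g h assume "g \<in> carrier (subgroup_generated P S)" "h \<in> carrier (subgroup_generated P S)"
      "\<phi> g = \<phi> h"
    then show "g = h" using left_unique[OF \<phi>_R, of g h] \<phi>_R[of h] by simp
  qed
  ultimately show ?thesis unfolding mon_def by blast
qed

text \<open>The numbering \<open>1, \<dots>, v\<close> of the points along the cycle in terms of the numbering of the cells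
  along the belt. The cycle goes up the even cells \<open>0, 2, 4, \<dots>\<close>, which are the points
  \<open>2, 3, 4, \<dots>\<close>, and returns down the odd cells, of which cell \<open>3\<close>, if present, is the point \<open>v\<close> and
  cell \<open>1\<close> the point \<open>1\<close>. Starting with the point \<open>2\<close> at cell \<open>0\<close> puts the points
  \<open>1, 2, 3\<close> on the cells \<open>1, 0, 2\<close> at the beginning of every belt.\<close>

definition zigzag :: "nat \<Rightarrow> nat \<Rightarrow> nat" where
  "zigzag v m = (if even m then m div 2 + 2 else if m = 1 then 1 else v + 1 - m div 2)"

lemma bij_zigzag:
  assumes "v \<ge> 3" shows "bij_betw (zigzag v) {..<v} {1..v}"
proof (rule bij_betw_byWitness[where
      f' = "\<lambda>j. if j = 1 then 1 else if 2 * (j - 2) < v then 2 * (j - 2) else 2 * (v + 1 - j) + 1"])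
  let ?w = "\<lambda>j. if j = 1 then 1 else if 2 * (j - 2) < v then 2 * (j - 2) else 2 * (v + 1 - j) + 1"
  show "\<forall>m\<in>{..<v}. ?w (zigzag v m) = m"
  proof
    fix m assume "m \<in> {..<v}"
    then show "?w (zigzag v m) = m"
      by (cases "even m") (auto simp: zigzag_def elim!: evenE oddE)
  qed
  show "\<forall>j\<in>{1..v}. zigzag v (?w j) = j"
    using assms by (auto simp: zigzag_def)
  show "zigzag v ` {..<v} \<subseteq> {1..v}"
    using assms by (auto simp: zigzag_def elim!: evenE oddE)
  show "?w ` {1..v} \<subseteq> {..<v}"
    using assms by auto
qed

text \<open>In terms of points modulo \<open>v\<close>, the two swapping involutions are the reflections
  \<open>j \<mapsto> 3 - j\<close> and \<open>j \<mapsto> 4 - j\<close>, whose product is the rotation by one.\<close>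

lemma zigzag_reflections:
  assumes "3 \<le> v" "m < v"
  shows "zigzag v (path_swap odd v (path_swap even v m)) = (if zigzag v m = v then 1 else zigzag v m + 1)"
proof (cases "even m")
  case True
  then obtain k where "m = 2 * k" by blast
  then show ?thesis using assms by (auto simp: zigzag_def path_swap_def)
next
  case False
  then obtain k where "m = 2 * k + 1" using oddE by blast
  then show ?thesis using assms by (cases k) (auto simp: zigzag_def path_swap_def)
qed

locale neumann_coding = belt_shift p "n ` {1..}" hi lo \<Sigma>
  for p :: nat and n :: "nat \<Rightarrow> nat" and hi lo :: 'a and \<Sigma> :: "'a set" +
  fixes u :: "nat \<Rightarrow> nat \<Rightarrow> 'u"
  assumes u_inj: "inj_on (\<lambda>(i, j). u i j) (SIGMA i:{1..}. {1..n i})"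
begin

abbreviation "P \<equiv> neumann_product n u"
abbreviation "Q \<equiv> Aut_full_shift \<Sigma>"
abbreviation "pts \<equiv> neumann_points n u"

definition pt :: "nat \<Rightarrow> nat \<Rightarrow> 'u" where
  "pt i m = u i (zigzag (n i) m)"

lemma n_ge: "1 \<le> i \<Longrightarrow> 3 \<le> n i"
  using N_ge by simp

lemma u_i_inj:
  assumes "1 \<le> i" shows "inj_on (u i) {1..n i}"
proof (rule inj_onI)
  fix j k assume "j \<in> {1..n i}" "k \<in> {1..n i}" "u i j = u i k"
  then show "j = k" using inj_onD[OF u_inj, of "(i, j)" "(i, k)"] assms by simp
qed

lemma bij_pt: "1 \<le> i \<Longrightarrow> bij_betw (pt i) {..<n i} (pts i)"
  using bij_betw_trans[OF bij_zigzag[OF n_ge] inj_on_imp_bij_betw[OF u_i_inj]]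
  by (simp add: pt_def[abs_def] comp_def neumann_points_def)

lemma pt_in: "1 \<le> i \<Longrightarrow> m < n i \<Longrightarrow> pt i m \<in> pts i"
  using bij_betwE[OF bij_pt] by simp

lemma group_P: "group P"
  unfolding neumann_product_def by (rule product_group) (rule group_BijGroup)

lemma P_component: "g \<in> carrier P \<Longrightarrow> 1 \<le> i \<Longrightarrow> g i \<in> Bij (pts i)"
  by (auto simp: neumann_product_def BijGroup_def)

lemma P_mult_apply:
  assumes "g \<in> carrier P" "h \<in> carrier P" "1 \<le> i" "z \<in> pts i"
  shows "(g \<otimes>\<^bsub>P\<^esub> h) i z = g i (h i z)"
  using P_component[OF assms(1,3)] P_component[OF assms(2,3)] assms(3,4)
  by (simp add: neumann_product_def BijGroup_def compose_eq)

lemma P_one_apply: "1 \<le> i \<Longrightarrow> z \<in> pts i \<Longrightarrow> \<one>\<^bsub>P\<^esub> i z = z"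
  by (simp add: neumann_product_def BijGroup_def)

lemma P_eqI:
  assumes g: "g \<in> carrier P" and h: "h \<in> carrier P"
    and eq: "\<And>i m. 1 \<le> i \<Longrightarrow> m < n i \<Longrightarrow> g i (pt i m) = h i (pt i m)"
  shows "g = h"
proof
  fix i show "g i = h i"
  proof (cases "1 \<le> i")
    case True
    have "g i z = h i z" if "z \<in> pts i" for z
    proof -
      have "z \<in> pt i ` {..<n i}" using that bij_betw_imp_surj_on[OF bij_pt[OF True]] by simp
      then show ?thesis using eq[OF True] by auto
    qed
    then show ?thesis
      using P_component[OF g True] P_component[OF h True] by (intro extensionalityI) (auto simp: Bij_def)
  next
    case False
    then show ?thesis using g h by (simp add: neumann_product_def PiE_def extensional_def)
  qed
qed

text \<open>The element of the product group whose \<open>i\<close>-th component is the permutation \<open>\<sigma> (n i)\<close> of the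
  cells of a belt of length \<open>n i\<close>, read as points.\<close>

definition permute :: "(nat \<Rightarrow> nat \<Rightarrow> nat) \<Rightarrow> nat \<Rightarrow> 'u \<Rightarrow> 'u" where
  "permute \<sigma> = (\<lambda>i\<in>{1..}. \<lambda>z\<in>pts i. pt i (\<sigma> (n i) (inv_into {..<n i} (pt i) z)))"

lemma permute_pt: "1 \<le> i \<Longrightarrow> m < n i \<Longrightarrow> permute \<sigma> i (pt i m) = pt i (\<sigma> (n i) m)"
  using bij_betw_imp_inj_on[OF bij_pt] by (simp add: permute_def pt_in)

lemma permute_in_P:
  assumes "\<And>i. 1 \<le> i \<Longrightarrow> bij_betw (\<sigma> (n i)) {..<n i} {..<n i}"
  shows "permute \<sigma> \<in> carrier P"
proof -
  have "permute \<sigma> i \<in> Bij (pts i)" if i: "1 \<le> i" for i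
  proof -
    have "bij_betw (pt i \<circ> (\<sigma> (n i) \<circ> inv_into {..<n i} (pt i))) (pts i) (pts i)"
      by (intro bij_betw_trans[OF bij_betw_trans[OF bij_betw_inv_into[OF bij_pt[OF i]] assms[OF i]] bij_pt[OF i]])
    then have "bij_betw (permute \<sigma> i) (pts i) (pts i)"
      by (rule bij_betw_cong[THEN iffD1, rotated]) (use i in \<open>simp add: permute_def\<close>)
    then show ?thesis using i unfolding Bij_def permute_def by simp
  qed
  then show ?thesis by (auto simp: neumann_product_def BijGroup_def permute_def)
qed

text \<open>The relation between elements of the product group and automorphisms from which the
  embedding is obtained.\<close>

definition corresponds :: "(nat \<Rightarrow> 'u \<Rightarrow> 'u) \<Rightarrow> ((int \<Rightarrow> 'a) \<Rightarrow> (int \<Rightarrow> 'a)) \<Rightarrow> bool" where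
  "corresponds g f \<longleftrightarrow> f \<in> carrier Q \<and> (\<exists>\<sigma>. acts \<sigma> f \<and> g = permute \<sigma>)"

lemma Q_mult:
  assumes "f \<in> carrier Q" "g \<in> carrier Q" shows "f \<otimes>\<^bsub>Q\<^esub> g = compose (topspace FS) f g"
proof -
  have "f \<in> Bij (topspace FS)" "g \<in> Bij (topspace FS)"
    using assms subgroup.subset[OF subgroup_Aut_full_shift[of \<Sigma>]] by (auto simp: BijGroup_def)
  then show ?thesis by (simp add: Aut_full_shift_def BijGroup_def)
qed

lemma Q_one: "\<one>\<^bsub>Q\<^esub> = (\<lambda>x\<in>topspace FS. x)"
  by (simp add: Aut_full_shift_def BijGroup_def)

lemma acts_permute_in_P:
  assumes "acts \<sigma> f" shows "permute \<sigma> \<in> carrier P"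
  by (rule permute_in_P) (rule acts_bij[OF assms], simp)

lemma permute_compose:
  assumes "acts \<sigma> f" "acts \<tau> g"
  shows "permute \<sigma> \<otimes>\<^bsub>P\<^esub> permute \<tau> = permute (\<lambda>v. \<sigma> v \<circ> \<tau> v)"
proof (rule P_eqI)
  note in_P = acts_permute_in_P[OF assms(1)] acts_permute_in_P[OF assms(2)]
  show "permute \<sigma> \<otimes>\<^bsub>P\<^esub> permute \<tau> \<in> carrier P"
    using group.is_monoid[OF group_P] in_P by (rule monoid.m_closed)
  show "permute (\<lambda>v. \<sigma> v \<circ> \<tau> v) \<in> carrier P"
    by (rule acts_permute_in_P[OF acts_compose[OF assms]])
  fix i m assume im: "1 \<le> i" "m < n i"
  have "\<tau> (n i) m < n i" using acts_less[OF assms(2)] im by simp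
  then show "(permute \<sigma> \<otimes>\<^bsub>P\<^esub> permute \<tau>) i (pt i m) = permute (\<lambda>v. \<sigma> v \<circ> \<tau> v) i (pt i m)"
    using P_mult_apply[OF in_P im(1) pt_in[OF im]] im by (simp add: permute_pt)
qed

lemma corresponds_mult:
  assumes "corresponds g f" "corresponds g' f'"
  shows "corresponds (g \<otimes>\<^bsub>P\<^esub> g') (f \<otimes>\<^bsub>Q\<^esub> f')"
proof -
  obtain \<sigma> \<tau> where *: "acts \<sigma> f" "g = permute \<sigma>" "acts \<tau> f'" "g' = permute \<tau>"
    and Q: "f \<in> carrier Q" "f' \<in> carrier Q"
    using assms unfolding corresponds_def by blast
  have "f \<otimes>\<^bsub>Q\<^esub> f' \<in> carrier Q"
    using group.is_monoid[OF group_Aut_full_shift] Q by (rule monoid.m_closed)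
  moreover have "acts (\<lambda>v. \<sigma> v \<circ> \<tau> v) (f \<otimes>\<^bsub>Q\<^esub> f')"
    unfolding Q_mult[OF Q] by (rule acts_compose[OF *(1,3)])
  ultimately show ?thesis
    unfolding corresponds_def *(2,4) permute_compose[OF *(1,3)] by blast
qed

lemma corresponds_one: "corresponds \<one>\<^bsub>P\<^esub> \<one>\<^bsub>Q\<^esub>"
proof -
  have "acts (\<lambda>v m. m) (\<lambda>x\<in>topspace FS. x)"
    unfolding acts_def finsupp_def by (auto simp: bij_betw_def)
  moreover from this have "\<one>\<^bsub>P\<^esub> = permute (\<lambda>v m. m)"
    using group.is_monoid[OF group_P]
    by (intro P_eqI acts_permute_in_P) (auto simp: permute_pt P_one_apply pt_in)
  moreover have "\<one>\<^bsub>Q\<^esub> \<in> carrier Q" 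
    by (rule monoid.one_closed[OF group.is_monoid[OF group_Aut_full_shift]])
  ultimately show ?thesis unfolding corresponds_def Q_one by blast
qed

lemma corresponds_one_left:
  assumes "corresponds \<one>\<^bsub>P\<^esub> f" shows "f = \<one>\<^bsub>Q\<^esub>"
proof -
  obtain \<sigma> where s: "acts \<sigma> f" "\<one>\<^bsub>P\<^esub> = permute \<sigma>" "f \<in> carrier Q"
    using assms unfolding corresponds_def by blast
  have "\<sigma> v m = m" if "v \<in> n ` {1..}" "m < v" for v m
  proof -
    obtain i where i: "1 \<le> i" "v = n i" using \<open>v \<in> n ` {1..}\<close> by auto
    have "pt i (\<sigma> (n i) m) = permute \<sigma> i (pt i m)" using permute_pt i that(2) by simp
    also have "\<dots> = pt i m" unfolding s(2)[symmetric] using P_one_apply pt_in i that(2) by simp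
    finally show ?thesis
      using bij_betw_imp_inj_on[OF bij_pt[OF i(1)]] acts_less[OF s(1) that] that(2) i(2)
      by (auto dest: inj_onD)
  qed
  then show ?thesis unfolding Q_one using Aut_eq_one_if_acts_trivially[OF s(3,1)] by blast
qed

lemma corresponds_one_right:
  assumes "corresponds g \<one>\<^bsub>Q\<^esub>" shows "g = \<one>\<^bsub>P\<^esub>"
proof -
  obtain \<sigma> where s: "acts \<sigma> \<one>\<^bsub>Q\<^esub>" "g = permute \<sigma>" using assms unfolding corresponds_def by blast
  have triv: "\<sigma> (n i) m = m" if "1 \<le> i" "m < n i" for i m
    using trivial_if_acts_by_identity[OF s(1)[unfolded Q_one]] that by simp
  show ?thesis
  proof (rule P_eqI)
    show "g \<in> carrier P" unfolding s(2) by (rule acts_permute_in_P[OF s(1)])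
    show "\<one>\<^bsub>P\<^esub> \<in> carrier P" using group.is_monoid[OF group_P] by (rule monoid.one_closed)
    show "g i (pt i m) = \<one>\<^bsub>P\<^esub> i (pt i m)" if "1 \<le> i" "m < n i" for i m
      using permute_pt triv P_one_apply pt_in that unfolding s(2) by simp
  qed
qed

text \<open>The pairs generate a subgroup of the direct product. As they are involutions, an induction
  over the generated subgroup only has to show that \<open>corresponds\<close> is multiplicative.\<close>

definition swap_pairs :: "((nat \<Rightarrow> 'u \<Rightarrow> 'u) \<times> ((int \<Rightarrow> 'a) \<Rightarrow> (int \<Rightarrow> 'a))) set" where
  "swap_pairs = {(permute (path_swap V), marked_swap W) | W V. marking W V}"

lemma swap_pair_corresponds:
  "(g, f) \<in> swap_pairs \<Longrightarrow> corresponds g f"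
  unfolding swap_pairs_def corresponds_def using acts_marked_swap marked_swap_in_Aut by blast

lemma swap_pair_involution:
  assumes "x \<in> swap_pairs" shows "inv\<^bsub>P \<times>\<times> Q\<^esub> x = x"
proof -
  obtain W V where x: "x = (permute (path_swap V), marked_swap W)" and W: "marking W V"
    using assms unfolding swap_pairs_def by blast
  note f = acts_marked_swap[OF W]
  have V: "\<not> V (Suc m)" if "V m" for m using W that unfolding marking_def by blast
  have "permute (path_swap V) \<otimes>\<^bsub>P\<^esub> permute (path_swap V) = \<one>\<^bsub>P\<^esub>"
    unfolding permute_compose[OF f f]
  proof (rule P_eqI)
    show "permute (\<lambda>v. path_swap V v \<circ> path_swap V v) \<in> carrier P"
      by (rule acts_permute_in_P[OF acts_compose[OF f f]])
    show "\<one>\<^bsub>P\<^esub> \<in> carrier P" using group.is_monoid[OF group_P] by (rule monoid.one_closed)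
    show "permute (\<lambda>v. path_swap V v \<circ> path_swap V v) i (pt i m) = \<one>\<^bsub>P\<^esub> i (pt i m)"
      if "1 \<le> i" "m < n i" for i m
      using that path_swap_path_swap[of V m "n i"] V by (simp add: permute_pt P_one_apply pt_in)
  qed
  moreover have "marked_swap W \<otimes>\<^bsub>Q\<^esub> marked_swap W = \<one>\<^bsub>Q\<^esub>"
    unfolding Q_mult[OF marked_swap_in_Aut[OF W] marked_swap_in_Aut[OF W]] Q_one compose_def
    using marked_swap_involution[OF W] by (intro restrict_ext)
  ultimately show ?thesis
    unfolding x using acts_permute_in_P[OF f] marked_swap_in_Aut[OF W]
    by (intro group.inv_equality[OF DirProd_group[OF group_P group_Aut_full_shift]]) auto
qed

lemma generated_by_swaps_corresponds:
  "x \<in> generate (P \<times>\<times> Q) swap_pairs \<Longrightarrow> corresponds (fst x) (snd x)"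
proof (induction rule: generate.induct)
  case one
  then show ?case using corresponds_one by simp
next
  case (incl x)
  then show ?case using swap_pair_corresponds by (metis prod.collapse)
next
  case (inv x)
  then show ?case using swap_pair_corresponds swap_pair_involution by (metis prod.collapse)
next
  case (eng x y)
  then show ?case using corresponds_mult by (simp add: mult_DirProd')
qed

lemma neumann_a_eq:
  "neumann_a n u = permute (path_swap (\<lambda>m. m = 1)) \<otimes>\<^bsub>P\<^esub> permute (path_swap (\<lambda>m. m = 0))"
  unfolding permute_compose[OF acts_marked_swap[OF marking_second] acts_marked_swap[OF marking_first]]
proof (rule P_eqI)
  show "neumann_a n u \<in> carrier P" using neumann_generators_in_carrier[of n u] n_ge by blast
  show "permute (\<lambda>v. path_swap (\<lambda>m. m = 1) v \<circ> path_swap (\<lambda>m. m = 0) v) \<in> carrier P"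
    by (rule acts_permute_in_P[OF acts_compose[OF acts_marked_swap[OF marking_second]
            acts_marked_swap[OF marking_first]]])
  fix i m assume i: "1 \<le> i" and m: "m < n i"
  have n: "3 \<le> n i" using n_ge i by simp
  \<comment> \<open>These are the points moved by \<open>a\<close>, listed in the order in which \<open>a\<close> permutes them.\<close>
  have pt012: "u i 1 = pt i 1" "u i 2 = pt i 0" "u i 3 = pt i 2" by (simp_all add: pt_def zigzag_def numeral_2_eq_2 numeral_3_eq_3)
  have inj: "pt i k = pt i l \<longleftrightarrow> k = l" if "k < n i" "l < n i" for k l
    using bij_betw_imp_inj_on[OF bij_pt[OF i]] that by (auto simp: inj_on_eq_iff)
  have "neumann_a n u i (pt i m) = cycle_of_list [u i 1, u i 2, u i 3] (pt i m)"
    using i pt_in[OF i m] unfolding neumann_a_def by simp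
  also have "\<dots> = cycle_of_list [pt i 1, pt i 0, pt i 2] (pt i m)" unfolding pt012 ..
  also have "\<dots> = pt i (path_swap (\<lambda>m. m = 1) (n i) (path_swap (\<lambda>m. m = 0) (n i) m))"
    using n m by (auto simp: transpose_def inj path_swap_def)
  finally show "neumann_a n u i (pt i m) =
      permute (\<lambda>v. path_swap (\<lambda>m. m = 1) v \<circ> path_swap (\<lambda>m. m = 0) v) i (pt i m)"
    unfolding permute_pt[OF i m] comp_def .
qed

lemma neumann_b_eq: "neumann_b n u = permute (path_swap odd) \<otimes>\<^bsub>P\<^esub> permute (path_swap even)"
  unfolding permute_compose[OF acts_marked_swap[OF marking_odd] acts_marked_swap[OF marking_even]]
proof (rule P_eqI)
  show "neumann_b n u \<in> carrier P" using neumann_generators_in_carrier[of n u] n_ge by blast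
  show "permute (\<lambda>v. path_swap odd v \<circ> path_swap even v) \<in> carrier P"
    by (rule acts_permute_in_P[OF acts_compose[OF acts_marked_swap[OF marking_odd]
            acts_marked_swap[OF marking_even]]])
  fix i m assume i: "1 \<le> i" and m: "m < n i"
  let ?l = "map (u i) [1..<Suc (n i)]"
  have "distinct ?l" using u_i_inj[OF i] by (simp add: distinct_map atLeastLessThanSuc_atLeastAtMost del: upt_Suc)
  then have "map (cycle_of_list ?l) ?l = rotate1 ?l" using cyclic_rotation[of ?l 1] by simp
  then have rot: "cycle_of_list ?l (?l ! k) = ?l ! (Suc k mod n i)" if "k < n i" for k
    using that nth_rotate1[of k ?l] nth_map[of k ?l "cycle_of_list ?l"] by (simp del: upt_Suc)
  have cyc: "cycle_of_list ?l (u i j) = u i (if j = n i then 1 else j + 1)" if "j \<in> {1..n i}" for j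
    using rot[of "j - 1"] that by (auto simp: nth_append simp del: upt_Suc)
  have z: "zigzag (n i) m \<in> {1..n i}" using bij_betwE[OF bij_zigzag[OF n_ge[OF i]]] m by simp
  have "neumann_b n u i (pt i m) = cycle_of_list ?l (pt i m)"
    using i pt_in[OF i m] unfolding neumann_b_def by simp
  also have "\<dots> = pt i (path_swap odd (n i) (path_swap even (n i) m))"
    unfolding pt_def cyc[OF z] zigzag_reflections[OF n_ge[OF i] m] by simp
  finally show "neumann_b n u i (pt i m) = permute (\<lambda>v. path_swap odd v \<circ> path_swap even v) i (pt i m)"
    unfolding permute_pt[OF i m] comp_def .
qed

lemma neumann_group_embeds: "in_class_G \<Sigma> (generalized_neumann_group n u)"
proof -
  let ?R = "generate (P \<times>\<times> Q) swap_pairs"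
  note grp = DirProd_group[OF group_P group_Aut_full_shift[of \<Sigma>]]
  have "swap_pairs \<subseteq> carrier (P \<times>\<times> Q)"
    using acts_marked_swap acts_permute_in_P marked_swap_in_Aut unfolding swap_pairs_def by auto
  then have R: "subgroup ?R (P \<times>\<times> Q)" by (rule group.generate_is_subgroup[OF grp])
  have product: "permute (path_swap V) \<otimes>\<^bsub>P\<^esub> permute (path_swap V') \<in> fst ` ?R"
    if "marking W V" "marking W' V'" for W V W' V'
  proof -
    have "(permute (path_swap V), marked_swap W) \<in> ?R" "(permute (path_swap V'), marked_swap W') \<in> ?R"
      using that unfolding swap_pairs_def by (blast intro: generate.incl)+
    then have "(permute (path_swap V), marked_swap W) \<otimes>\<^bsub>P \<times>\<times> Q\<^esub> (permute (path_swap V'), marked_swap W') \<in> ?R"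
      by (rule generate.eng)
    then show ?thesis unfolding mult_DirProd by force
  qed
  have "neumann_a n u \<in> fst ` ?R" "neumann_b n u \<in> fst ` ?R"
    unfolding neumann_a_eq neumann_b_eq
    using product[OF marking_second marking_first] product[OF marking_odd marking_even] by blast+
  then have gens: "{neumann_a n u, neumann_b n u} \<subseteq> fst ` ?R" by blast
  have corr: "corresponds g f" if "(g, f) \<in> ?R" for g f
    using generated_by_swaps_corresponds[OF that] by simp
  have "mon (subgroup_generated P {neumann_a n u, neumann_b n u}) Q \<noteq> {}"
  proof (rule mon_from_correspondence[OF group_P group_Aut_full_shift R _ _ gens])
    show "f = \<one>\<^bsub>Q\<^esub>" if "(\<one>\<^bsub>P\<^esub>, f) \<in> ?R" for f by (rule corresponds_one_left[OF corr[OF that]])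
    show "g = \<one>\<^bsub>P\<^esub>" if "(g, \<one>\<^bsub>Q\<^esub>) \<in> ?R" for g by (rule corresponds_one_right[OF corr[OF that]])
  qed
  then have "mon (generalized_neumann_group n u) Q \<noteq> {}" unfolding generalized_neumann_group_def .
  moreover have "group (generalized_neumann_group n u)"
    unfolding generalized_neumann_group_def by (rule group.group_subgroup_generated[OF group_P])
  ultimately show ?thesis unfolding in_class_G_def by blast
qed

end

theorem lemma10:
  fixes \<Sigma> :: "'a set" and n :: "nat \<Rightarrow> nat" and u :: "nat \<Rightarrow> nat \<Rightarrow> 'u"
  assumes "finite \<Sigma>" and "card \<Sigma> \<ge> 2"
    and "n 1 \<ge> 3" and "strict_mono_on {1..} n"
    and "eventually_periodic_seq n"
    and "inj_on (\<lambda>(i, j). u i j) (SIGMA i:{1..}. {1..n i})"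
  shows "in_class_G \<Sigma> (generalized_neumann_group n u)"
proof -
  obtain hi lo where hl: "hi \<in> \<Sigma>" "lo \<in> \<Sigma>" "hi \<noteq> lo"
  proof -
    have "\<not> card \<Sigma> \<le> 1" using assms(2) by simp
    then show thesis using that card_le_Suc0_iff_eq[OF assms(1)] by auto
  qed
  obtain q n0 where q: "q \<ge> 1" "\<And>v. v \<ge> n0 \<Longrightarrow> v \<in> n ` {1..} \<longleftrightarrow> v + q \<in> n ` {1..}"
    using assms(5) unfolding eventually_periodic_seq_def by blast
  \<comment> \<open>A multiple of the given period which is even and beyond the point from which the periodicity
    holds.\<close>
  define p where "p = q * (2 * (n0 + 2))"
  have "2 * (n0 + 2) \<le> p" using mult_le_mono1[OF q(1), of "2 * (n0 + 2)"] unfolding p_def by simp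
  then have p: "even p" "4 \<le> p" "n0 \<le> p" unfolding p_def by auto
  have mult: "v + q * k \<in> n ` {1..} \<longleftrightarrow> v \<in> n ` {1..}" if "v \<ge> n0" for v k
  proof (induction k)
    case (Suc k)
    have step: "v + q * Suc k = (v + q * k) + q" by simp
    show ?case unfolding step using q(2)[of "v + q * k"] that Suc by simp
  qed simp
  have ge3: "n i \<ge> 3" if "i \<ge> 1" for i
    using strict_mono_on_leD[OF assms(4), of 1 i] that assms(3) by simp
  interpret neumann_coding p n hi lo \<Sigma> u
  proof
    show "even p" "4 \<le> p" "hi \<noteq> lo" "hi \<in> \<Sigma>" "lo \<in> \<Sigma>" by (fact p hl)+
    show "3 \<le> v" if "v \<in> n ` {1..}" for v using that ge3 by auto
    show "v + p \<in> n ` {1..} \<longleftrightarrow> v \<in> n ` {1..}" if "p \<le> v" for v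
      using mult[of v "2 * (n0 + 2)"] that p(3) unfolding p_def by linarith
    show "inj_on (\<lambda>(i, j). u i j) (SIGMA i:{1..}. {1..n i})" by (fact assms(6))
  qed
  show ?thesis by (rule neumann_group_embeds)
qed

end
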